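(* (1) Let $(x_n)_{n\in\mathbb{Z}}$ be the Tripell sequence, defined by $x_n=2x_{n-1}+x_{n-2}+x_{n-3}$ for all $n\in\mathbb{Z}$ with $x_0=0$, $x_1=1$, $x_2=2$. Then the Marques–Lengyel conjecture fails for $(x_n)$ and every prime $p\in[5,250]\setminus\{5,19,29,41,103,137,151,191\}$, and holds for $(x_n)$ and every $p\in\{103,137,191\}$. (2) Let $(x_n)_{n\in\mathbb{Z}}$ be the modified Tripell sequence, defined by $x_n=2x_{n-1}+2x_{n-2}+x_{n-3}$ for all $n\in\mathbb{Z}$ with $x_0=0$, $x_1=1$, $x_2=2$. Then the Marques–Lengyel conjecture fails for $(x_n)$ and every prime $p\in[5,250]\setminus\{5,7,23,41,83,131,193,227\}$, and holds for $(x_n)$ and every $p\in\{5,23,41,131,193,227\}$.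
   Context: For a nonzero rational $r$, $\nu_p(r)$ is the exponent of $p$ in $r$, and $\nu_p(0)=\infty$. The Marques–Lengyel conjecture holds for a sequence $(x_n)_{n\in\mathbb{Z}}$ and a prime $p$ if there is a positive integer $Q$ such that for every $i\in\{0,1,\dots,Q-1\}$ one of the following holds: (C) there is $\kappa_i\in\mathbb{Z}_{\ge0}$ such that $\nu_p(x_n)=\kappa_i$ for all but finitely many $n\in\mathbb{Z}$ with $n\equiv i\pmod Q$; or (L) there exist $a_i\in\mathbb{Z}$, $\kappa_i\in\mathbb{Z}$, $\mu_i\in\mathbb{Z}_{>0}$ with $\nu_p(a_i-i)\ge\nu_p(Q)$ such that $\nu_p(x_n)=\kappa_i+\mu_i\nu_p(n-a_i)$ for all but finitely many $n\in\mathbb{Z}$ with $n\equiv i\pmod Q$. The primes in the statement range over primes in the indicated interval. *)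

theory Defs
  imports
    "HOL-Computational_Algebra.Computational_Algebra"
    "HOL-Number_Theory.Cong"
    "HOL-Library.Extended_Real"
begin

definition nu :: "nat \<Rightarrow> rat \<Rightarrow> ereal" where
  "nu p r =
     (if r = 0 then \<infinity>
      else ereal (real (multiplicity (int p) (fst (quotient_of r)))
                  - real (multiplicity (int p) (snd (quotient_of r)))))"

definition eventually_constant_nu :: "(int \<Rightarrow> rat) \<Rightarrow> nat \<Rightarrow> int \<Rightarrow> int \<Rightarrow> bool" where
  "eventually_constant_nu x p Q i \<longleftrightarrow>
     (\<exists>\<kappa>::int. \<kappa> \<ge> 0 \<and>
        finite {n. [n = i] (mod Q) \<and> nu p (x n) \<noteq> ereal (of_int \<kappa>)})"

definition eventually_linear_nu :: "(int \<Rightarrow> rat) \<Rightarrow> nat \<Rightarrow> int \<Rightarrow> int \<Rightarrow> bool" where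
  "eventually_linear_nu x p Q i \<longleftrightarrow>
     (\<exists>(a::int) (\<kappa>::int) (\<mu>::int). \<mu> > 0 \<and>
        nu p (of_int (a - i)) \<ge> nu p (of_int Q) \<and>
        finite {n. [n = i] (mod Q) \<and>
          nu p (x n) \<noteq> ereal (of_int \<kappa>) + ereal (of_int \<mu>) * nu p (of_int (n - a))})"

definition marques_lengyel :: "(int \<Rightarrow> rat) \<Rightarrow> nat \<Rightarrow> bool" where
  "marques_lengyel x p \<longleftrightarrow>
     (\<exists>Q::int. Q > 0 \<and>
        (\<forall>i\<in>{0..Q - 1}. eventually_constant_nu x p Q i \<or> eventually_linear_nu x p Q i))"

definition is_tripell :: "(int \<Rightarrow> rat) \<Rightarrow> bool" where
  "is_tripell x \<longleftrightarrow>
     (\<forall>n. x n = 2 * x (n - 1) + x (n - 2) + x (n - 3)) \<and> x 0 = 0 \<and> x 1 = 1 \<and> x 2 = 2"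

definition is_modified_tripell :: "(int \<Rightarrow> rat) \<Rightarrow> bool" where
  "is_modified_tripell x \<longleftrightarrow>
     (\<forall>n. x n = 2 * x (n - 1) + 2 * x (n - 2) + x (n - 3)) \<and> x 0 = 0 \<and> x 1 = 1 \<and> x 2 = 2"

text \<open>Both recurrences can be run backwards, so each of the two predicates describes exactly
  one sequence; this is the case \<open>a = 2\<close>, \<open>b \<in> {1, 2}\<close> of the following fact.\<close>

lemma two_sided_recurrence_ex1:
  fixes a b u v w :: rat
  shows "\<exists>!x :: int \<Rightarrow> rat.
    (\<forall>n. x n = a * x (n - 1) + b * x (n - 2) + x (n - 3)) \<and> x 0 = u \<and> x 1 = v \<and> x 2 = w"
proof (rule ex_ex1I)
  define T where "T = (\<lambda>(p, q, r). (q :: rat, r, a * r + b * q + p))"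
  define S where "S = (\<lambda>(p, q, r). (r - a * q - b * p :: rat, p, q))"
  define s where "s = (\<lambda>n::int. if n \<ge> 0 then (T ^^ nat n) (u, v, w) else (S ^^ nat (- n)) (u, v, w))"
  have TS: "T (S z) = z" for z
    by (cases z) (simp add: T_def S_def)
  have step: "s (n + 1) = T (s n)" for n
  proof (cases "n \<ge> 0")
    case True
    then have "nat (n + 1) = Suc (nat n)" by simp
    with True show ?thesis by (simp add: s_def)
  next
    case False
    then have *: "nat (- n) = Suc (nat (- (n + 1)))" by simp
    show ?thesis
    proof (cases "n = -1")
      case True
      then show ?thesis by (simp add: s_def TS)
    next
      case n: False
      with False have "s (n + 1) = (S ^^ nat (- (n + 1))) (u, v, w)" by (simp add: s_def)
      moreover from False have "s n = (S ^^ Suc (nat (- (n + 1)))) (u, v, w)"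
        unfolding s_def * by simp
      ultimately show ?thesis by (simp add: TS)
    qed
  qed
  define x where "x = (\<lambda>n. fst (s n))"
  have T1: "fst (T z) = fst (snd z)" "fst (snd (T z)) = snd (snd z)"
    "snd (snd (T z)) = a * snd (snd z) + b * fst (snd z) + fst z" for z
    by (cases z; simp add: T_def)+
  have s2: "s (n + 2) = T (T (s n))" for n
    using step[of n] step[of "n + 1"] by (simp add: add.assoc)
  have s3: "s (n + 3) = T (T (T (s n)))" for n
    using s2[of n] step[of "n + 2"] by (simp add: add.assoc)
  have sh: "x (n + 1) = fst (snd (s n))" "x (n + 2) = snd (snd (s n))"
    "x (n + 3) = a * snd (snd (s n)) + b * fst (snd (s n)) + fst (s n)" for n
    using step[of n] s2[of n] s3[of n] by (simp_all add: x_def T1)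
  have "x n = a * x (n - 1) + b * x (n - 2) + x (n - 3)" for n
    using sh[of "n - 3"] by (simp add: x_def)
  moreover have "x 0 = u \<and> x 1 = v \<and> x 2 = w"
    using sh[of 0] by (simp add: x_def s_def)
  ultimately show "\<exists>x :: int \<Rightarrow> rat.
    (\<forall>n. x n = a * x (n - 1) + b * x (n - 2) + x (n - 3)) \<and> x 0 = u \<and> x 1 = v \<and> x 2 = w"
    by blast
next
  fix x y :: "int \<Rightarrow> rat"
  assume x: "(\<forall>n. x n = a * x (n - 1) + b * x (n - 2) + x (n - 3)) \<and> x 0 = u \<and> x 1 = v \<and> x 2 = w"
    and y: "(\<forall>n. y n = a * y (n - 1) + b * y (n - 2) + y (n - 3)) \<and> y 0 = u \<and> y 1 = v \<and> y 2 = w"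
  have X: "x n = a * x (n - 1) + b * x (n - 2) + x (n - 3)" for n
    using x by blast
  have Y: "y n = a * y (n - 1) + b * y (n - 2) + y (n - 3)" for n
    using y by blast
  have I: "x 0 = y 0" "x 1 = y 1" "x 2 = y 2"
    using x[THEN conjunct2] y[THEN conjunct2] by simp_all
  have up: "x (n + 3) = y (n + 3)" if "x n = y n" "x (n + 1) = y (n + 1)" "x (n + 2) = y (n + 2)" for n
  proof -
    have e: "n + 3 - 1 = n + 2" "n + 3 - 2 = n + 1" "n + 3 - 3 = n" by simp_all
    show ?thesis using X[of "n + 3"] Y[of "n + 3"] that unfolding e by metis
  qed
  have down: "x (n - 1) = y (n - 1)" if "x n = y n" "x (n + 1) = y (n + 1)" "x (n + 2) = y (n + 2)" for n
  proof -
    have e: "n + 2 - 1 = n + 1" "n + 2 - 2 = n" "n + 2 - 3 = n - 1" by simp_all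
    show ?thesis using X[of "n + 2"] Y[of "n + 2"] that unfolding e by (metis add_left_cancel)
  qed
  have "x n = y n \<and> x (n + 1) = y (n + 1) \<and> x (n + 2) = y (n + 2)" for n
  proof (induction n rule: int_induct[where k = 0])
    case base
    then show ?case using I by simp
  next
    case (step1 n)
    then show ?case using up[of n] by (simp add: add.assoc)
  next
    case (step2 n)
    then show ?case using down[of n] by (simp add: add.commute)
  qed
  then show "x = y" by blast
qed

lemma ex1_tripell: "\<exists>!x. is_tripell x"
  using two_sided_recurrence_ex1[of 2 1 0 1 2] unfolding is_tripell_def mult_1_left .

lemma ex1_modified_tripell: "\<exists>!x. is_modified_tripell x"
  unfolding is_modified_tripell_def by (rule two_sided_recurrence_ex1)

end

theory Submission
  imports Defs "HOL-Analysis.Analysis"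
begin

text \<open>
  Write \<open>X n = \<beta>\<^sub>1 + \<beta>\<^sub>2 + \<beta>\<^sub>3\<close> with \<open>\<beta>\<^sub>i = l\<^sub>i\<^sup>n\<^sup>+\<^sup>1 / \<chi>'(l\<^sub>i)\<close>, where the \<open>l\<^sub>i\<close> are the roots of
  \<open>\<chi> = z\<^sup>3 - 2 z\<^sup>2 - b z - 1\<close> (\<open>b = 1, 2\<close>), and let \<open>N\<close> be a period modulo \<open>p\<close>. On each class modulo \<open>N\<close> the
  sequence is, up to \<open>p\<^sup>s\<^sup>+\<^sup>2\<close>, affine in an argument divisible by \<open>p\<^sup>s\<close>, so a simple zero modulo \<open>p\<^sup>2\<close> lifts to
  a \<open>p\<close>-adic zero. If the only zero classes are those of the integer zeros \<open>0\<close> and \<open>-1\<close>, the valuation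
  is constant or linear on every class, and \<open>0\<close>, \<open>-1\<close> are the only zeros of \<open>X\<close>.

  If the conjecture holds at \<open>p\<close>, every \<open>p\<close>-adic zero is an integer \<open>a\<close>, although \<open>a\<close> need not lie in the
  class modulo \<open>N\<close>. Eliminating the approximate roots of unity \<open>l\<^sub>i\<^sup>n\<^sup>-\<^sup>a\<close>, where \<open>n\<close> tends to \<open>a\<close> and
  \<open>X n\<close> to \<open>0\<close> \<open>p\<close>-adically, gives a complex relation \<open>\<beta>\<^sub>1(a) + \<xi> \<beta>\<^sub>2(a) + \<eta> \<beta>\<^sub>3(a) = 0\<close> with roots of unity
  \<open>\<xi>\<close>, \<open>\<eta>\<close>. As \<open>l\<^sub>1\<close> is real and \<open>l\<^sub>3\<close> is the complex conjugate of \<open>l\<^sub>2\<close>, this is an isosceles triangle, hence \<open>\<eta> = \<xi>\<^sup>-\<^sup>1\<close>;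
  comparing the Galois conjugate relation with its complex conjugate leaves only cube roots of unity,
  and the nontrivial ones are excluded because \<open>3 |disc \<chi>|\<close> is not a square. So \<open>X a = 0\<close> and
  \<open>a \<in> {0, -1}\<close>, which fails as soon as some \<open>p\<close>-adic zero is not congruent to \<open>0\<close> or \<open>-1\<close> modulo \<open>p\<close>.
\<close>

section \<open>Newton expansion of the recurrence along a period\<close>

definition recurs :: "int \<Rightarrow> (int \<Rightarrow> 'a::comm_ring_1) \<Rightarrow> bool" where
  "recurs b f \<longleftrightarrow> (\<forall>n. f (n + 3) = 2 * f (n + 2) + of_int b * f (n + 1) + f n)"

lemma recursD: "recurs b f \<Longrightarrow> f (n + 3) = 2 * f (n + 2) + of_int b * f (n + 1) + f n"
  by (simp add: recurs_def)

lemma recurs_eq_zero: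
  fixes f :: "int \<Rightarrow> 'a::comm_ring_1"
  assumes f: "recurs b f" and "f 0 = 0" "f 1 = 0" "f 2 = 0"
  shows "f n = 0"
proof -
  have "f n = 0 \<and> f (n + 1) = 0 \<and> f (n + 2) = 0"
  proof (induction n rule: int_induct[where k = 0])
    case base
    then show ?case using assms by simp
  next
    case (step1 n)
    then show ?case using recursD[OF f, of n] by (simp add: add.assoc)
  next
    case (step2 n)
    have "n - 1 + 3 = n + 2" "n - 1 + 2 = n + 1" "n - 1 + 1 = n" by simp_all
    with step2 show ?case using recursD[OF f, of "n - 1"] by (simp only:) simp
  qed
  then show ?thesis by simp
qed

lemma recurs_shift: "recurs b f \<Longrightarrow> recurs b (\<lambda>n. f (m + n))"
  by (simp add: recurs_def add.assoc[symmetric])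

lemma recurs_add: "recurs b f \<Longrightarrow> recurs b g \<Longrightarrow> recurs b (\<lambda>n. f n + g n)"
  by (simp add: recurs_def algebra_simps)

lemma recurs_diff: "recurs b f \<Longrightarrow> recurs b g \<Longrightarrow> recurs b (\<lambda>n. f n - g n)"
  by (simp add: recurs_def algebra_simps)

lemma recurs_scale: "recurs b f \<Longrightarrow> recurs b (\<lambda>n. f n * c)"
  by (simp add: recurs_def algebra_simps)

lemma recurs_of_int: "recurs b f \<Longrightarrow> recurs b (\<lambda>n. of_int (f n) :: 'a::comm_ring_1)"
  by (simp add: recurs_def)

locale tripell_seq =
  fixes b :: int and X :: "int \<Rightarrow> int"
  assumes rec: "recurs b X" and X0: "X 0 = 0" and X1: "X 1 = 1" and X2: "X 2 = 2"
begin

lemma X_neg: "X (-1) = 0" "X (-2) = 1"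
proof -
  show a: "X (-1) = 0" using recursD[OF rec, of "-1"] by (simp add: X0 X1 X2)
  show "X (-2) = 1" using recursD[OF rec, of "-2"] by (simp add: X0 X1 X2 a)
qed

text \<open>Both sides solve the recurrence in \<open>n\<close> and agree at 0, 1, 2. The period
  operator, the powers of the roots and the residue computations all rest on this formula.\<close>

lemma recurs_addition:
  fixes f :: "int \<Rightarrow> 'a::comm_ring_1"
  assumes f: "recurs b f"
  shows "f (m + n) = of_int (X (n - 1)) * f (m + 2) + of_int (X n - 2 * X (n - 1)) * f (m + 1)
    + of_int (X (n - 2)) * f m"
proof -
  have s: "recurs b (\<lambda>n. X (n - k))" for k
    using recurs_shift[OF rec, of "- k"] by simp
  have "recurs b (\<lambda>n. of_int (X (n - 1)) * f (m + 2) + of_int (X n - 2 * X (n - 1)) * f (m + 1)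
    + of_int (X (n - 2)) * f m)"
    by (intro recurs_add recurs_scale recurs_of_int recurs_diff s rec)
      (use recurs_scale[OF s[of 1], of 2] in \<open>simp add: mult.commute\<close>)
  note * = recurs_diff[OF recurs_shift[OF f, of m] this]
  show ?thesis
    using recurs_eq_zero[OF *, of n] by (simp add: X0 X1 X2 X_neg)
qed

end

section \<open>Divisibility of the higher Newton terms\<close>

lemma add_two_le_power:
  fixes p :: nat
  assumes "p \<ge> 3" "v > 0"
  shows "v + 2 \<le> p ^ v"
proof -
  have "v + 2 \<le> 3 ^ v" using assms(2)
    by (induction v rule: nat_induct_non_zero) auto
  also have "\<dots> \<le> p ^ v" using assms by (intro power_mono) auto
  finally show ?thesis .
qed

text \<open>Since \<open>j * (l choose j)\<close> is \<open>l\<close> times a binomial coefficient,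
  \<open>l choose j\<close> falls short of \<open>p ^ s\<close> by at most
  \<open>v = multiplicity p j\<close> factors \<open>p\<close>. The factor \<open>p ^ j\<close>
  restores them with two to spare: for \<open>v > 0\<close> one has
  \<open>j \<ge> p ^ v \<ge> v + 2\<close>, where \<open>p \<ge> 3\<close> enters.\<close>

lemma prime_power_dvd_binomial:
  fixes p :: nat
  assumes p: "prime p" "p \<ge> 3" and j: "j \<ge> 2" and l: "p ^ s dvd l"
  shows "p ^ (s + 2) dvd (l choose j) * p ^ j"
proof (cases "l = 0")
  case True
  then have "(l choose j) = 0" using j by (simp add: binomial_eq_0)
  then show ?thesis by (simp only: mult_zero_left dvd_0_right)
next
  case False
  then obtain l' where l': "l = Suc l'" by (cases l) auto
  obtain j' where j': "j = Suc j'" using j by (cases j) auto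
  have "j * (l choose j) = l * (l' choose j')"
    unfolding l' j' using Suc_times_binomial_eq[of l' j'] by (simp add: mult.commute)
  then have 1: "p ^ s dvd j * (l choose j)" using l by simp
  define v where "v = multiplicity p j"
  have "j \<noteq> 0" "\<not> is_unit p" using j p by auto
  then obtain u where u: "j = p ^ v * u" "\<not> p dvd u"
    using multiplicity_decompose'[of j p] unfolding v_def by metis
  have cop: "coprime (p ^ s) u"
    using p(1) u(2) by (simp add: prime_imp_coprime)
  have "p ^ s dvd u * (p ^ v * (l choose j))"
    using 1 u(1) by (simp add: ac_simps)
  then have 2: "p ^ s dvd p ^ v * (l choose j)"
    using cop coprime_dvd_mult_right_iff by blast
  have vj: "v + 2 \<le> j"
  proof (cases "v = 0")
    case False
    have "p ^ v \<le> j" using u(1) \<open>j \<noteq> 0\<close> by (simp add: dvd_imp_le)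
    then show ?thesis using add_two_le_power[OF p(2), of v] False by simp
  qed (use j in simp)
  have "p ^ s * p ^ 2 dvd (p ^ v * (l choose j)) * p ^ (j - v)"
    by (rule mult_dvd_mono[OF 2]) (use vj in \<open>simp add: le_imp_power_dvd\<close>)
  also have "(p ^ v * (l choose j)) * p ^ (j - v) = (l choose j) * (p ^ v * p ^ (j - v))"
    by (simp only: ac_simps)
  also have "p ^ v * p ^ (j - v) = p ^ j" using vj by (simp add: power_add[symmetric])
  finally show ?thesis by (simp only: power_add)
qed

locale tripell_period = tripell_seq +
  fixes p N :: nat
  assumes p: "prime p" "p \<ge> 3" and period: "[X (int N - 1) = 0] (mod int p)"
    "[X (int N) = 0] (mod int p)" "[X (int N - 2) = 1] (mod int p)" and N_pos: "N > 0"
begin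

text \<open>With E the shift by one on solutions, this is (E^N - 1) / p, written out by the addition
  formula; the period congruences make the three quotients exact.\<close>

definition T :: "(int \<Rightarrow> int) \<Rightarrow> int \<Rightarrow> int" where
  "T f m = (X (int N - 1) div p) * f (m + 2) + ((X N - 2 * X (int N - 1)) div p) * f (m + 1)
    + ((X (int N - 2) - 1) div p) * f m"

lemma shift_N:
  assumes "recurs b f"
  shows "f (m + int N) = f m + int p * T f m"
proof -
  have "int p dvd X (int N - 1)" "int p dvd X N" "int p dvd X (int N - 2) - 1"
    using period by (auto simp: cong_iff_dvd_diff)
  then obtain u v w :: int where "X (int N - 1) = p * u" "X N = p * v" "X (int N - 2) - 1 = p * w"
    unfolding dvd_def by auto
  moreover then have "X (int N - 2) = p * w + 1" "X N - 2 * X (int N - 1) = p * (v - 2 * u)"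
    by (auto simp: algebra_simps)
  moreover have "p > 0" using p by simp
  ultimately show ?thesis
    using recurs_addition[OF assms, of m N] by (simp add: T_def algebra_simps)
qed

lemma recurs_T: "recurs b f \<Longrightarrow> recurs b (T f)"
proof -
  assume f: "recurs b f"
  have s: "recurs b (\<lambda>n. c * f (n + k))" for c k
    using recurs_scale[OF recurs_shift[OF f, of k], of c] by (simp add: ac_simps)
  show ?thesis
    unfolding T_def[abs_def] using s[of _ 0] by (intro recurs_add s) simp
qed

lemma recurs_T_pow: "recurs b f \<Longrightarrow> recurs b ((T ^^ j) f)"
  by (induction j) (auto intro: recurs_T)

text \<open>As E^N = 1 + p T, this is the binomial theorem for E^(N l); the induction step is
  Pascal's rule.\<close>

lemma newton_expansion:
  assumes f: "recurs b f"
  shows "f (m + int N * int l) = (\<Sum>j\<le>l. int (l choose j) * int p ^ j * (T ^^ j) f m)"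
proof (induction l arbitrary: m)
  case 0
  then show ?case by simp
next
  case (Suc l)
  define h where "h = (\<lambda>j. int p ^ j * (T ^^ j) f m)"
  have h: "int p ^ j * (T ^^ j) f (m + N) = h j + h (Suc j)" for j
    unfolding h_def by (simp add: shift_N[OF recurs_T_pow[OF f]] algebra_simps)
  have "f (m + int N * int (Suc l)) = f ((m + N) + int N * int l)" by (simp add: algebra_simps)
  also have "\<dots> = (\<Sum>j\<le>l. int (l choose j) * (h j + h (Suc j)))"
    unfolding Suc.IH by (intro sum.cong refl) (simp only: mult.assoc h)
  also have "\<dots> = (\<Sum>j\<le>l. int (l choose j) * h j) + (\<Sum>j\<le>l. int (l choose j) * h (Suc j))"
    by (simp add: distrib_left sum.distrib)
  also have "(\<Sum>j\<le>l. int (l choose j) * h j) = (\<Sum>j\<le>Suc l. int (l choose j) * h j)"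
    by simp
  also have "\<dots> = h 0 + (\<Sum>j\<le>l. int (l choose Suc j) * h (Suc j))"
    by (subst sum.atMost_Suc_shift) simp
  also have "\<dots> + (\<Sum>j\<le>l. int (l choose j) * h (Suc j)) =
      h 0 + (\<Sum>j\<le>l. int (Suc l choose Suc j) * h (Suc j))"
    by (simp add: algebra_simps sum.distrib)
  also have "\<dots> = (\<Sum>j\<le>Suc l. int (Suc l choose j) * h j)"
    unfolding sum.atMost_Suc_shift[of "\<lambda>j. int (Suc l choose j) * h j"] by simp
  finally show ?case by (simp add: h_def mult.assoc)
qed

lemma newton_mod_nat:
  assumes f: "recurs b f" and l: "p ^ s dvd l"
  shows "[f (m + int N * int l) = f m + int l * (f (m + N) - f m)] (mod int p ^ (s + 2))"
proof -
  \<comment> \<open>Only the terms \<open>j = 0\<close> and \<open>j = 1\<close> survive modulo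
    \<open>p ^ (s + 2)\<close>.\<close>
  have d: "int p ^ (s + 2) dvd int (l choose j) * int p ^ j" if "j \<ge> 2" for j
    using prime_power_dvd_binomial[OF p that l] by (metis of_nat_dvd_iff of_nat_mult of_nat_power)
  define g where "g = (\<lambda>j. int (l choose j) * int p ^ j * (T ^^ j) f m)"
  have split: "sum g {..l} = g 0 + (if l = 0 then 0 else g 1) + sum g {2..l}"
  proof (cases "l = 0")
    case False
    then have "{..l} = insert 0 (insert 1 {2..l})" by auto
    then show ?thesis using False by simp
  qed simp
  have 2: "int p ^ (s + 2) dvd sum g {2..l}"
    by (intro dvd_sum) (unfold g_def, rule d[THEN dvd_mult2], simp)
  have "f (m + int N * int l) - (f m + int l * (f (m + N) - f m)) = sum g {2..l}"
    unfolding newton_expansion[OF f] g_def[symmetric] split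
    by (auto simp: g_def shift_N[OF f])
  then show ?thesis using 2 by (simp add: cong_iff_dvd_diff)
qed

lemma period_mod_p:
  assumes f: "recurs b f"
  shows "[f (m + int N * l) = f m] (mod int p)"
proof (induction l rule: int_induct[where k = 0])
  case (step1 l)
  have "[f (m + int N * l + N) = f (m + int N * l)] (mod int p)"
    by (simp add: shift_N[OF f] cong_iff_dvd_diff)
  then show ?case using step1 cong_trans by (simp add: algebra_simps) blast
next
  case (step2 l)
  have "[f (m + int N * (l - 1) + N) = f (m + int N * (l - 1))] (mod int p)"
    by (simp add: shift_N[OF f] cong_iff_dvd_diff)
  then have "[f (m + int N * l) = f (m + int N * (l - 1))] (mod int p)"
    by (simp add: algebra_simps)
  then show ?case using step2 cong_trans cong_sym by blast
qed simp

text \<open>The difference is \<open>p\<close> times \<open>T f\<close>, and \<open>T f\<close>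
  again solves the recurrence, hence has period \<open>N\<close> modulo \<open>p\<close>.\<close>

lemma diff_mod_p2:
  assumes f: "recurs b f"
  shows "[f (m + int N * l + N) - f (m + int N * l) = f (m + N) - f m] (mod int p ^ 2)"
proof -
  have "[T f (m + int N * l) = T f m] (mod int p)"
    by (rule period_mod_p[OF recurs_T[OF f]])
  then show ?thesis
    unfolding shift_N[OF f]
    by (simp add: power2_eq_square cong_iff_dvd_diff right_diff_distrib[symmetric])
qed

lemma newton_mod:
  assumes f: "recurs b f" and l: "int p ^ s dvd l"
  shows "[f (m + int N * l) = f m + l * (f (m + N) - f m)] (mod int p ^ (s + 2))"
proof (cases "l \<ge> 0")
  case True
  have "p ^ s dvd nat l" using l True
    by (metis int_dvd_int_iff int_nat_eq of_nat_power)
  from newton_mod_nat[OF f this, of m] True show ?thesis by simp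
next
  case False
  have "p ^ s dvd nat (- l)" using l False
    by (metis int_dvd_int_iff int_nat_eq of_nat_power dvd_minus_iff minus_equation_iff
        linear neg_0_le_iff_le)
  \<comment> \<open>For negative \<open>l\<close> the natural case runs from
    \<open>m + int N * l\<close> back to \<open>m\<close>. The increments at the two ends agree
    modulo \<open>p ^ 2\<close>, and \<open>l\<close> supplies the remaining factor
    \<open>p ^ s\<close>.\<close>
  from newton_mod_nat[OF f this, of "m + int N * l"] False
  have 1: "[f m = f (m + int N * l) - l * (f (m + int N * l + N) - f (m + int N * l))]
      (mod int p ^ (s + 2))"
    by simp
  have "int p ^ s * int p ^ 2 dvd l * ((f (m + int N * l + N) - f (m + int N * l)) - (f (m + N) - f m))"
    using diff_mod_p2[OF f, of m l] by (intro mult_dvd_mono l) (simp add: cong_iff_dvd_diff)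
  then have "int p ^ (s + 2) dvd l * ((f (m + int N * l + N) - f (m + int N * l)) - (f (m + N) - f m))"
    by (simp only: power_add)
  with 1 have "int p ^ (s + 2) dvd (f m - (f (m + int N * l) - l * (f (m + int N * l + N) - f (m + int N * l))))
     - l * ((f (m + int N * l + N) - f (m + int N * l)) - (f (m + N) - f m))"
    unfolding cong_iff_dvd_diff by (rule dvd_diff)
  also have "\<dots> = - (f (m + int N * l) - (f m + l * (f (m + N) - f m)))"
    by (simp add: algebra_simps)
  finally show ?thesis unfolding cong_iff_dvd_diff by (simp only: dvd_minus_iff)
qed

text \<open>Newton's method: the increment over one period is \<open>p * T X n\<close> with
  \<open>T X n\<close> a unit modulo \<open>p\<close>, so moving the index by
  \<open>N * p ^ (k + 1) * t\<close> changes \<open>X\<close> by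
  \<open>p ^ (k + 2) * T X n * t\<close> modulo \<open>p ^ (k + 3)\<close>, and \<open>t\<close> can
  be chosen to cancel the next digit. The index moves by multiples of \<open>p\<close>, so its
  residue modulo \<open>p\<close> is kept.\<close>

lemma hensel:
  assumes r: "int p ^ 2 dvd X r" and c: "\<not> int p ^ 2 dvd X (r + N) - X r"
  shows "\<exists>l. int p ^ (k + 2) dvd X (r + int N * (int p * l))"
proof (induction k)
  case 0
  then show ?case using r by (intro exI[of _ 0]) (simp add: power2_eq_square)
next
  case (Suc k)
  then obtain l where l: "int p ^ (k + 2) dvd X (r + int N * (int p * l))" by blast
  define n where "n = r + int N * (int p * l)"
  obtain y where y: "X n = int p ^ (k + 2) * y" using l unfolding n_def by auto
  have "X (n + N) - X n = p * T X n" by (simp add: shift_N[OF rec])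
  moreover have "\<not> int p ^ 2 dvd X (n + N) - X n"
    using diff_mod_p2[OF rec, of r "int p * l"] c unfolding n_def
    by (simp add: cong_dvd_iff)
  ultimately have "\<not> int p dvd T X n" by (auto simp: power2_eq_square)
  then have "coprime (T X n) (int p)"
    using p(1) by (simp add: coprime_commute prime_imp_coprime)
  then obtain t where "[T X n * t = - y] (mod int p)"
    using cong_solve_coprime_int[of "T X n" "int p"] 
    by (metis cong_scalar_right mult.assoc mult.commute mult_1)
  then have t: "int p dvd y + T X n * t" by (simp add: cong_iff_dvd_diff add.commute)
  have "[X (n + int N * (int p ^ (k + 1) * t)) = X n + (int p ^ (k + 1) * t) * (X (n + N) - X n)]
      (mod int p ^ (Suc k + 2))"
    using newton_mod[OF rec, of "k + 1" "int p ^ (k + 1) * t" n] by (simp add: ac_simps)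
  also have "X n + (int p ^ (k + 1) * t) * (X (n + N) - X n) = int p ^ (k + 2) * (y + T X n * t)"
    by (simp add: y shift_N[OF rec] algebra_simps power2_eq_square)
  finally have "int p ^ (Suc k + 2) dvd X (n + int N * (int p ^ (k + 1) * t)) \<longleftrightarrow>
      int p ^ (Suc k + 2) dvd int p ^ (k + 2) * (y + T X n * t)"
    by (rule cong_dvd_iff)
  moreover have "int p ^ (Suc k + 2) dvd int p ^ (k + 2) * (y + T X n * t)"
    using t by (simp add: mult.commute mult_dvd_mono)
  ultimately have "int p ^ (Suc k + 2) dvd X (n + int N * (int p ^ (k + 1) * t))" by simp
  also have "n + int N * (int p ^ (k + 1) * t) = r + int N * (int p * (l + int p ^ k * t))"
    by (simp add: n_def algebra_simps)
  finally show ?case by blast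
qed

lemma infinitely_many_divisible:
  assumes r: "int p ^ 2 dvd X r" and c: "\<not> int p ^ 2 dvd X (r + N) - X r"
  shows "\<exists>n. int p ^ k dvd X n \<and> \<bar>n\<bar> > B \<and> [n = r] (mod int p)"
proof -
  obtain l where l: "int p ^ (k + 2) dvd X (r + int N * (int p * l))"
    using hensel[OF r c] by blast
  define n where "n = r + int N * (int p * l)"
  \<comment> \<open>The power of \<open>p\<close> preserves divisibility by \<open>p ^ k\<close> and
    the class modulo \<open>p\<close>; the other factor pushes the index beyond
    \<open>B\<close>.\<close>
  define t where "t = int p ^ (k + 1) * (\<bar>n\<bar> + \<bar>B\<bar> + 1)"
  have kn: "int p ^ k dvd X n" using l unfolding n_def by (rule power_le_dvd) simp
  have "int p ^ k dvd t" unfolding t_def by simp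
  then have "[X (n + int N * t) = X n + t * (X (n + N) - X n)] (mod int p ^ k)"
    using newton_mod[OF rec, of k t n] cong_dvd_modulus[OF _ le_imp_power_dvd] by (metis le_add1)
  then have 1: "int p ^ k dvd X (n + int N * t)"
    using kn \<open>int p ^ k dvd t\<close> by (simp add: cong_dvd_iff)
  have "int N * int p ^ (k + 1) \<ge> 1" using N_pos p(2)
    by (simp add: Suc_le_eq int_one_le_iff_zero_less)
  then have "int N * t \<ge> 1 * (\<bar>n\<bar> + \<bar>B\<bar> + 1)" unfolding t_def mult.assoc[symmetric]
    by (intro mult_right_mono) auto
  then have 2: "\<bar>n + int N * t\<bar> > B"
    by simp
  have "[n + int N * t = r] (mod int p)"
    by (simp add: n_def t_def cong_iff_dvd_diff)
  with 1 2 show ?thesis by blast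
qed

end

section \<open>Valuations near a simple zero\<close>

lemma nu_of_int: "nu p (of_int z) = (if z = 0 then \<infinity> else ereal (real (multiplicity (int p) z)))"
  by (simp add: nu_def quotient_of_int)

lemma nu_of_int_ge_iff:
  assumes "prime p"
  shows "nu p (of_int z) \<ge> ereal (real k) \<longleftrightarrow> int p ^ k dvd z"
proof (cases "z = 0")
  case False
  have "\<not> is_unit (int p)" using assms not_prime_unit[of "int p"] by auto
  then show ?thesis using False power_dvd_iff_le_multiplicity[of z "int p" k] by (simp add: nu_of_int)
qed (simp add: nu_def)

text \<open>By the pigeonhole principle one class modulo \<open>Q\<close> contains indices with
  arbitrarily divisible \<open>X n\<close>. Alternative (C) bounds the valuation there, so (L)
  holds, and its linear law then drives \<open>n\<close> towards \<open>a\<close> p-adically;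
  \<open>a\<close> inherits the residue \<open>r\<close>.\<close>

lemma marques_lengyel_imp_integer_limit:
  fixes X :: "int \<Rightarrow> int"
  assumes p: "prime p" and ml: "marques_lengyel (\<lambda>n. of_int (X n)) p"
    and inf: "\<And>k B. \<exists>n. int p ^ k dvd X n \<and> \<bar>n\<bar> > B \<and> [n = r] (mod int p)"
  obtains a where "[a = r] (mod int p)" "\<And>m. \<exists>n. int p ^ m dvd n - a \<and> int p ^ m dvd X n"
proof -
  obtain Q where Q: "Q > 0"
    "\<And>i. i \<in> {0..Q - 1} \<Longrightarrow> eventually_constant_nu (\<lambda>n. of_int (X n)) p Q i \<or>
        eventually_linear_nu (\<lambda>n. of_int (X n)) p Q i"
    using ml unfolding marques_lengyel_def by blast
  \<comment> \<open>Here \<open>k\<close> is both exponent and size bound, so if every class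
    \<open>i\<close> failed at some \<open>K i\<close>, one index taken at the maximum
    \<open>M\<close> would refute this.\<close>
  define P where "P = (\<lambda>i k. \<exists>n. int p ^ k dvd X n \<and> \<bar>n\<bar> > int k \<and> [n = r] (mod int p) \<and> [n = i] (mod Q))"
  have "\<exists>i\<in>{0..Q - 1}. \<forall>k. P i k"
  proof (rule ccontr)
    assume "\<not> ?thesis"
    then obtain K where K: "\<And>i. i \<in> {0..Q - 1} \<Longrightarrow> \<not> P i (K i)" by metis
    define M where "M = Max (K ` {0..Q - 1})"
    have M: "K i \<le> M" if "i \<in> {0..Q - 1}" for i unfolding M_def using that by auto
    obtain n where n: "int p ^ M dvd X n" "\<bar>n\<bar> > int M" "[n = r] (mod int p)" using inf by blast
    define i where "i = n mod Q"
    have i: "i \<in> {0..Q - 1}" using Q(1) by (auto simp: i_def)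
    have "int p ^ K i dvd X n" using n(1) M[OF i] power_le_dvd by blast
    moreover have "\<bar>n\<bar> > int (K i)" using n(2) M[OF i] by linarith
    ultimately have "P i (K i)" unfolding P_def using n(3) by (auto simp: i_def cong_def)
    with K[OF i] show False by blast
  qed
  then obtain i where i: "i \<in> {0..Q - 1}" and P: "\<And>k. P i k" by blast
  have large: "\<exists>n. int p ^ k dvd X n \<and> n \<notin> F \<and> [n = r] (mod int p) \<and> [n = i] (mod Q)"
    if F: "finite F" for k F
  proof -
    define B where "B = Max (insert 0 ((\<lambda>n. nat \<bar>n\<bar>) ` F))"
    have B: "nat \<bar>n\<bar> \<le> B" if "n \<in> F" for n unfolding B_def using F that by auto
    from P[of "max k B"] obtain n where n: "int p ^ max k B dvd X n" "\<bar>n\<bar> > int (max k B)"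
      "[n = r] (mod int p)" "[n = i] (mod Q)" unfolding P_def by blast
    have "n \<notin> F" using B[of n] n(2) by auto
    moreover have "int p ^ k dvd X n" using n(1) by (rule power_le_dvd) simp
    ultimately show ?thesis using n by blast
  qed
  from Q(2)[OF i] show ?thesis
  proof
    assume "eventually_constant_nu (\<lambda>n. of_int (X n)) p Q i"
    then obtain \<kappa> :: int where \<kappa>: "\<kappa> \<ge> 0"
      "finite {n. [n = i] (mod Q) \<and> nu p (of_int (X n)) \<noteq> ereal (of_int \<kappa>)}" (is "finite ?F")
      unfolding eventually_constant_nu_def by blast
    from large[OF \<kappa>(2), of "nat \<kappa> + 1"] obtain n where
      n: "int p ^ (nat \<kappa> + 1) dvd X n" "n \<notin> ?F" "[n = i] (mod Q)" by blast
    have "nu p (of_int (X n)) = ereal (of_int \<kappa>)" using n by simp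
    moreover have "nu p (of_int (X n)) \<ge> ereal (real (nat \<kappa> + 1))"
      using n(1) nu_of_int_ge_iff[OF p] by blast
    ultimately show ?thesis using \<kappa>(1) by simp
  next
    assume "eventually_linear_nu (\<lambda>n. of_int (X n)) p Q i"
    then obtain a \<kappa> \<mu> :: int where \<mu>: "\<mu> > 0" and F:
      "finite {n. [n = i] (mod Q) \<and>
          nu p (of_int (X n)) \<noteq> ereal (of_int \<kappa>) + ereal (of_int \<mu>) * nu p (of_int (n - a))}" (is "finite ?F")
      unfolding eventually_linear_nu_def by blast
    have close: "\<exists>n. int p ^ m dvd n - a \<and> int p ^ m dvd X n \<and> [n = r] (mod int p)" for m
    proof -
      \<comment> \<open>Chosen with \<open>k \<ge> \<kappa> + \<mu> * m\<close>, so that the linear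
        law gives \<open>n - a\<close> valuation at least \<open>m\<close>, and with
        \<open>k \<ge> m\<close>, so that \<open>p ^ m\<close> divides \<open>X n\<close> as
        well.\<close>
      define k where "k = nat \<bar>\<kappa>\<bar> + nat \<mu> * m + m"
      from large[OF F, of k] obtain n where
        n: "int p ^ k dvd X n" "n \<notin> ?F" "[n = i] (mod Q)" "[n = r] (mod int p)" by blast
      have eq: "nu p (of_int (X n)) = ereal (of_int \<kappa>) + ereal (of_int \<mu>) * nu p (of_int (n - a))"
        using n by simp
      have ge: "nu p (of_int (X n)) \<ge> ereal (real k)"
        using n(1) nu_of_int_ge_iff[OF p] by blast
      have "nu p (of_int (n - a)) \<ge> ereal (real m)"
      proof (cases "n = a")
        case False
        then obtain v where v: "nu p (of_int (n - a)) = ereal (real v)"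
          by (auto simp: nu_of_int simp del: of_int_diff)
        have "real k \<le> of_int \<kappa> + of_int \<mu> * real v" using eq ge v by simp
        moreover have "real k \<ge> of_int \<kappa> + of_int \<mu> * real m"
          unfolding k_def using \<mu> by simp
        ultimately have "of_int \<mu> * real m \<le> of_int \<mu> * real v" by linarith
        then show ?thesis using \<mu> v by simp
      qed (simp add: nu_def)
      then have "int p ^ m dvd n - a" using nu_of_int_ge_iff[OF p] by blast
      moreover have "int p ^ m dvd X n" using n(1) by (rule power_le_dvd) (simp add: k_def)
      ultimately show ?thesis using n(4) by blast
    qed
    from close[of 1] obtain n where "int p dvd n - a" "[n = r] (mod int p)" by auto
    then have "[a = r] (mod int p)"
      using cong_trans[OF cong_sym, of n a "int p" r] by (simp add: cong_iff_dvd_diff)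
    with close that show ?thesis by blast
  qed
qed

section \<open>Primes where the conjecture holds: valuations on the classes of 0 and -1\<close>

context tripell_period
begin

text \<open>Newton's congruence turns \<open>X (a + N * l)\<close> into \<open>l * X (a + N)\<close>
  modulo \<open>p ^ (s + 2)\<close>, with \<open>s\<close> the valuation of \<open>l\<close>, and
  \<open>p\<close> divides \<open>X (a + N)\<close> exactly once.\<close>

lemma multiplicity_near_zero:
  assumes a: "X a = 0" and c: "\<not> int p ^ 2 dvd X (a + N)" and l: "l \<noteq> 0"
  shows "X (a + int N * l) \<noteq> 0" "multiplicity (int p) (X (a + int N * l)) = 1 + multiplicity (int p) l"
proof -
  define s where "s = multiplicity (int p) l"
  have pp: "prime (int p)" using p(1) by simp
  have nu: "\<not> is_unit (int p)" using pp not_prime_unit by blast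
  obtain u where u: "l = int p ^ s * u" "\<not> int p dvd u"
    using multiplicity_decompose'[OF l nu] unfolding s_def by metis
  define t where "t = T X a"
  have t: "X (a + N) = int p * t" using shift_N[OF rec, of a] by (simp add: a t_def)
  with c have "\<not> int p dvd t" by (auto simp: power2_eq_square)
  then have ut: "\<not> int p dvd u * t" using u(2) pp prime_dvd_mult_iff by blast
  have "[X (a + int N * l) = l * X (a + N)] (mod int p ^ (s + 2))"
    using newton_mod[OF rec, of s l a] u(1) by (simp add: a)
  then have cg: "[X (a + int N * l) = int p ^ (s + 1) * (u * t)] (mod int p ^ (s + 2))"
    by (simp add: u(1) t ac_simps)
  then have "[X (a + int N * l) = int p ^ (s + 1) * (u * t)] (mod int p ^ (s + 1))"
    by (rule cong_dvd_modulus) simp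
  then have d1: "int p ^ (s + 1) dvd X (a + int N * l)" by (simp add: cong_dvd_iff)
  have "int p ^ (s + 1) \<noteq> 0" using p by simp
  then have "\<not> int p ^ (s + 1) * int p dvd int p ^ (s + 1) * (u * t)" using ut by (subst dvd_mult_cancel_left) simp
  then have d2: "\<not> int p ^ Suc (s + 1) dvd X (a + int N * l)"
    using cong_dvd_iff[OF cg] by (simp add: ac_simps)
  then show "X (a + int N * l) \<noteq> 0" by auto
  show "multiplicity (int p) (X (a + int N * l)) = 1 + multiplicity (int p) l"
    using multiplicity_eqI[OF d1 d2] by (simp add: s_def)
qed

end

text \<open>The only zero classes modulo \<open>N\<close> are those of 0 and of
  \<open>N - 1\<close>, that is of -1. The assumption \<open>simple\<close> says that their
  increments do not vanish modulo \<open>p ^ 2\<close>, and by \<open>pN\<close> the valuation of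
  \<open>N * l\<close> is that of \<open>l\<close>.\<close>

locale tripell_trivial_zeros = tripell_period +
  assumes nonzero: "\<And>i. 0 < i \<Longrightarrow> i < int N - 1 \<Longrightarrow> \<not> int p dvd X i"
    and simple: "\<not> int p ^ 2 dvd X (int N)" "\<not> int p ^ 2 dvd X (int N - 1)"
    and pN: "\<not> p dvd N"
begin

lemma class_decomp: "[n = i] (mod int N) \<Longrightarrow> \<exists>l. n = i + int N * l"
  by (drule cong_sym) (simp add: cong_iff_lin mult.commute)

lemma simple_zero: "a = 0 \<or> a = -1 \<Longrightarrow> X a = 0 \<and> \<not> int p ^ 2 dvd X (a + N)"
  using simple by (auto simp: X0 X_neg)

text \<open>A zero lies in the class of 0 or of -1, where \<open>multiplicity_near_zero\<close>
  leaves no second one. Obtained at one prime, this is a fact about \<open>X\<close> itself and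
  serves at all other primes.\<close>

lemma zeros: "X n = 0 \<longleftrightarrow> n = 0 \<or> n = -1"
proof
  assume n: "X n = 0"
  define i where "i = n mod int N"
  have "n = i + int N * (n div int N)" unfolding i_def by simp
  then obtain l where l: "n = i + int N * l" by blast
  have i: "0 \<le> i" "i < N" using N_pos by (auto simp: i_def)
  have "int p dvd X i" using cong_dvd_iff[OF period_mod_p[OF rec, of i l]] n l by simp
  with nonzero[of i] i have "i = 0 \<or> i = int N - 1" by linarith
  then show "n = 0 \<or> n = -1"
  proof
    assume "i = 0"
    then show ?thesis using multiplicity_near_zero(1)[of 0 l] simple_zero[of 0] n l by auto
  next
    assume i: "i = int N - 1"
    \<comment> \<open>The class of \<open>N - 1\<close> is recentred at the zero -1, which shifts
      \<open>l\<close> by one.\<close>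
    then have "n = -1 + int N * (l + 1)" using l by (simp add: algebra_simps)
    then show ?thesis using multiplicity_near_zero(1)[of "-1" "l + 1"] simple_zero[of "-1"] n by auto
  qed
qed (auto simp: X0 X_neg)

lemma linear_class:
  assumes a: "a = 0 \<or> a = -1" and i: "[i = a] (mod int N)"
  shows "eventually_linear_nu (\<lambda>n. of_int (X n)) p (int N) i"
proof -
  have pN': "\<not> int p dvd int N" using pN by simp
  \<comment> \<open>Here \<open>\<kappa> = 1\<close> is the single factor \<open>p\<close> of the
    increment, and \<open>\<mu> = 1\<close> reflects a simple zero; at \<open>n = a\<close> both
    sides are infinite.\<close>
  have "nu p (of_int (X n)) = ereal (of_int 1) + ereal (of_int 1) * nu p (of_int (n - a))"
    if "[n = i] (mod int N)" for n
  proof -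
    from that i have "[n = a] (mod int N)" by (rule cong_trans)
    then obtain l where l: "n = a + int N * l" using class_decomp by blast
    show ?thesis
    proof (cases "l = 0")
      case True
      then show ?thesis using simple_zero[OF a] l by (simp add: nu_of_int nu_def)
    next
      case False
      have 1: "multiplicity (int p) (int N * l) = multiplicity (int p) l"
        using False N_pos pN' p(1) by (subst prime_elem_multiplicity_mult_distrib) (auto simp: not_dvd_imp_multiplicity_0)
      have 2: "n - a = int N * l" "int N * l \<noteq> 0" using l False N_pos by auto
      show ?thesis unfolding 2(1) unfolding nu_of_int
        using multiplicity_near_zero[of a l] simple_zero[OF a] False 1 2(2) by (simp add: l)
    qed
  qed
  then have e: "{n. [n = i] (mod int N) \<and> nu p (of_int (X n)) \<noteq>
      ereal (of_int 1) + ereal (of_int 1) * nu p (of_int (n - a))} = {}" by blast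
  have "nu p (of_int (int N)) = 0" unfolding nu_of_int
    using N_pos pN' by (simp add: not_dvd_imp_multiplicity_0 zero_ereal_def)
  moreover have "nu p (of_int (a - i)) \<ge> 0" unfolding nu_of_int by simp
  ultimately have "nu p (of_int (int N)) \<le> nu p (of_int (a - i))" by (simp only:)
  then show ?thesis unfolding eventually_linear_nu_def
    by (intro exI[of _ a] exI[of _ 1] conjI) (simp_all only: e finite.emptyI zero_less_one)
qed

lemma holds: "marques_lengyel (\<lambda>n. of_int (X n)) p"
proof -
  have "eventually_constant_nu (\<lambda>n. of_int (X n)) p (int N) i \<or>
        eventually_linear_nu (\<lambda>n. of_int (X n)) p (int N) i" if i: "i \<in> {0..int N - 1}" for i
  proof (cases "i = 0 \<or> i = int N - 1")
    case True
    then show ?thesis using linear_class[of 0 i] linear_class[of "-1" i] by (auto simp: cong_iff_dvd_diff)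
  next
    case False
    then have ni: "\<not> int p dvd X i" using nonzero i by auto
    have "nu p (of_int (X n)) = ereal (of_int 0)" if n: "[n = i] (mod int N)" for n
    proof -
      obtain l where l: "n = i + int N * l" using class_decomp[OF n] by blast
      then have "\<not> int p dvd X n" using period_mod_p[OF rec, of i l] ni by (simp add: cong_dvd_iff)
      then show ?thesis by (auto simp: nu_of_int not_dvd_imp_multiplicity_0)
    qed
    then have "{n. [n = i] (mod int N) \<and> nu p (of_int (X n)) \<noteq> ereal (of_int 0)} = {}" by blast
    then show ?thesis unfolding eventually_constant_nu_def
      by (intro disjI1 exI[of _ 0] conjI) (simp_all only: finite.emptyI order.refl)
  qed
  then show ?thesis unfolding marques_lengyel_def using N_pos by (intro exI[of _ "int N"]) auto
qed

end

section \<open>Finitely generated subrings and approximate roots of unity\<close>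

definition subring_on :: "complex set \<Rightarrow> bool" where
  "subring_on R \<longleftrightarrow> 1 \<in> R \<and> (\<forall>x\<in>R. \<forall>y\<in>R. x + y \<in> R \<and> x - y \<in> R \<and> x * y \<in> R)"

lemma subring_onD:
  assumes "subring_on R"
  shows "1 \<in> R" "0 \<in> R" "x \<in> R \<Longrightarrow> y \<in> R \<Longrightarrow> x + y \<in> R" "x \<in> R \<Longrightarrow> y \<in> R \<Longrightarrow> x - y \<in> R"
    "x \<in> R \<Longrightarrow> y \<in> R \<Longrightarrow> x * y \<in> R" "x \<in> R \<Longrightarrow> - x \<in> R"
proof -
  show "1 \<in> R" and 0: "0 \<in> R" using assms diff_self[of "1::complex"] unfolding subring_on_def by metis+
  show "x \<in> R \<Longrightarrow> y \<in> R \<Longrightarrow> x + y \<in> R" "x \<in> R \<Longrightarrow> y \<in> R \<Longrightarrow> x - y \<in> R"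
    "x \<in> R \<Longrightarrow> y \<in> R \<Longrightarrow> x * y \<in> R" using assms unfolding subring_on_def by blast+
  show "x \<in> R \<Longrightarrow> - x \<in> R" using 0 assms diff_0[of x] unfolding subring_on_def by metis
qed

lemma subring_on_power: "subring_on R \<Longrightarrow> x \<in> R \<Longrightarrow> x ^ n \<in> R"
  by (induction n) (auto intro: subring_onD)

lemma subring_on_prod: "subring_on R \<Longrightarrow> (\<And>i. i \<in> A \<Longrightarrow> f i \<in> R) \<Longrightarrow> prod f A \<in> R"
  by (induction A rule: infinite_finite_induct) (auto intro: subring_onD)

lemma subring_on_of_nat: "subring_on R \<Longrightarrow> of_nat n \<in> R"
  by (induction n) (auto intro: subring_onD)

lemma subring_on_of_int: "subring_on R \<Longrightarrow> of_int n \<in> R"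
  by (cases n) (auto intro: subring_onD(6) subring_on_of_nat simp del: of_nat_Suc)

interpretation Z: module "\<lambda>(c::int) (z::complex). of_int c * z"
  by unfold_locales (auto simp: algebra_simps)

interpretation QV: vector_space "\<lambda>(c::rat) (z::complex). of_rat c * z"
  by unfold_locales (auto simp: algebra_simps of_rat_add of_rat_mult)

interpretation QP: vector_space_pair "\<lambda>(c::rat) (z::complex). of_rat c * z" "(*) :: rat \<Rightarrow> rat \<Rightarrow> rat"
  by unfold_locales (auto simp: algebra_simps)

lemma finite_common_denominator:
  fixes f :: "'a \<Rightarrow> rat"
  assumes "finite G"
  shows "\<exists>d::nat. d > 0 \<and> (\<forall>x\<in>G. of_nat d * f x \<in> \<int>)"
  using assms
proof (induction G rule: finite_induct)
  case (insert x G)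
  then obtain d :: nat where d: "d > 0" "\<forall>x\<in>G. of_nat d * f x \<in> \<int>" by blast
  obtain u v where uv: "quotient_of (f x) = (u, v)" by (cases "quotient_of (f x)")
  have v: "v > 0" using quotient_of_denom_pos[OF uv] .
  have fx: "f x = of_int u / of_int v" using quotient_of_div[OF uv] .
  have "of_nat (d * nat v) * f y \<in> \<int>" if "y \<in> insert x G" for y
  proof (cases "y = x")
    case True
    have "of_nat (d * nat v) * f x = of_int (int d * u)" using v by (simp add: fx)
    then show ?thesis using True by (metis Ints_of_int)
  next
    case False
    then have "of_nat d * f y \<in> \<int>" using that d by simp
    then have "of_int v * (of_nat d * f y) \<in> \<int>" by (rule Ints_mult[OF Ints_of_int])
    moreover have "of_nat (d * nat v) * f y = of_int v * (of_nat d * f y)" using v by simp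
    ultimately show ?thesis by (simp only:)
  qed
  then show ?case using d v by (intro exI[of _ "d * nat v"]) auto
qed (auto intro: exI[of _ 1])

text \<open>If \<open>z\<close> were nonzero, some rational linear functional \<open>f\<close> would
  have \<open>f z = 1\<close> and send the span of \<open>G\<close> into fractions with a common
  denominator \<open>d\<close>. Then \<open>p ^ k\<close> would divide \<open>d\<close> for every
  \<open>k\<close>, which fails at \<open>k = d\<close> because \<open>d < p ^ d\<close>.\<close>

lemma infinitely_divisible_eq_zero:
  assumes "finite G" and p: "p \<ge> (2::nat)"
    and div: "\<And>k. \<exists>w\<in>Z.span G. z = of_nat p ^ k * w"
  shows "z = 0"
proof (rule ccontr)
  assume z: "z \<noteq> 0"
  then have "QV.independent {z}" by (simp add: QV.dependent_single)
  from QP.linear_independent_extend[OF this, of "\<lambda>_. 1"]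
  obtain f where f: "Vector_Spaces.linear (\<lambda>(c::rat) (z::complex). of_rat c * z) (*) f" "f z = 1" by auto
  interpret f: Vector_Spaces.linear "\<lambda>(c::rat) (z::complex). of_rat c * z" "(*) :: rat \<Rightarrow> rat \<Rightarrow> rat" f by fact
  obtain d :: nat where d: "d > 0" "\<forall>x\<in>G. of_nat d * f x \<in> \<int>"
    using finite_common_denominator[OF assms(1)] by blast
  have f_int: "f (of_int c * x) = of_int c * f x" for c x using f.scale[of "of_int c" x] by simp
  have sp: "of_nat d * f x \<in> \<int>" if "x \<in> Z.span G" for x
    using that
  proof (induction rule: Z.span_induct_alt)
    case base
    then show ?case by (simp add: f.zero)
  next
    case (step c x y)
    have "of_nat d * f (of_int c * x + y) = of_int c * (of_nat d * f x) + of_nat d * f y"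
      unfolding f.add f_int by (simp add: algebra_simps)
    then show ?case using step d by simp
  qed
  obtain w where w: "w \<in> Z.span G" "z = of_nat p ^ d * w" using div by blast
  from sp[OF w(1)] obtain u where u: "of_nat d * f w = of_int u" by (auto elim: Ints_cases)
  have "1 = of_nat p ^ d * f w" using f_int[of "int p ^ d" w] f(2) w(2) by simp
  then have "of_nat d = of_nat p ^ d * (of_nat d * f w)" by (simp add: algebra_simps)
  then have "of_int (int d) = (of_int (int p ^ d * u) :: rat)" unfolding u by simp
  then have "int d = int p ^ d * u" by (simp only: of_int_eq_iff)
  then have "int (p ^ d) dvd int d" by simp
  then have "p ^ d dvd d" by (simp only: int_dvd_int_iff)
  then have "p ^ d \<le> d" using d(1) by (rule dvd_imp_le)
  moreover have "d < p ^ d" using p by (simp add: power_gt_expt)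
  ultimately show False by simp
qed

lemma subring_on_Ints: "subring_on \<int>" "\<int> \<subseteq> Z.span {1}"
proof -
  show "subring_on \<int>" by (auto simp: subring_on_def)
  show "\<int> \<subseteq> Z.span {1}"
    using Z.span_scale[OF Z.span_base[of 1 "{1}"]] by (auto elim!: Ints_cases)
qed

text \<open>The new ring is R[t]: the monic relation reduces every polynomial in \<open>t\<close> to
  degree at most \<open>e\<close>, so the ring lies in the span of the products
  \<open>g * t ^ i\<close> with \<open>g\<close> in \<open>G\<close>.\<close>

lemma subring_on_adjoin_integral:
  assumes R: "subring_on R" and G: "finite G" "R \<subseteq> Z.span G"
    and t: "t ^ Suc e = (\<Sum>i<Suc e. c i * t ^ i)" "\<And>i. c i \<in> R"
  obtains R' G' where "subring_on R'" "R \<subseteq> R'" "t \<in> R'" "finite G'" "R' \<subseteq> Z.span G'"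
proof -
  define R' where "R' = {x. \<exists>r. (\<forall>i. r i \<in> R) \<and> x = (\<Sum>i<Suc e. r i * t ^ i)}"
  note Rs = subring_onD[OF R]
  have add: "x + y \<in> R'" if "x \<in> R'" "y \<in> R'" for x y
  proof -
    from that obtain r s where "\<forall>i. r i \<in> R" "x = (\<Sum>i<Suc e. r i * t ^ i)"
      "\<forall>i. s i \<in> R" "y = (\<Sum>i<Suc e. s i * t ^ i)" unfolding R'_def by blast
    then show ?thesis unfolding R'_def
      by (intro CollectI exI[of _ "\<lambda>i. r i + s i"]) (auto simp: Rs sum.distrib distrib_right)
  qed
  have scale: "a * x \<in> R'" if "x \<in> R'" "a \<in> R" for x a
  proof -
    from that obtain r where "\<forall>i. r i \<in> R" "x = (\<Sum>i<Suc e. r i * t ^ i)" unfolding R'_def by blast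
    then show ?thesis unfolding R'_def using that
      by (intro CollectI exI[of _ "\<lambda>i. a * r i"]) (auto simp: Rs sum_distrib_left mult.assoc distrib_left)
  qed
  have sub: "R \<subseteq> R'"
  proof
    fix x assume "x \<in> R"
    then show "x \<in> R'" unfolding R'_def
      by (intro CollectI exI[of _ "\<lambda>i. if i = 0 then x else 0"])
        (auto simp: Rs sum.lessThan_Suc_shift simp del: sum.lessThan_Suc)
  qed
  have mt: "t * x \<in> R'" if "x \<in> R'" for x
  proof -
    from that obtain r where r: "\<forall>i. r i \<in> R" "x = (\<Sum>i<Suc e. r i * t ^ i)" unfolding R'_def by blast
    \<comment> \<open>Multiplication by \<open>t\<close> shifts the coefficients up by one and
      spreads the top one over the relation for \<open>t ^ Suc e\<close>.\<close>
    define s where "s = (\<lambda>i. (if i = 0 then 0 else r (i - 1)) + r e * c i)"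
    have "t * x = (\<Sum>i<Suc e. r i * t ^ Suc i)" by (simp add: r(2) sum_distrib_left algebra_simps)
    also have "\<dots> = (\<Sum>i<e. r i * t ^ Suc i) + r e * t ^ Suc e" by simp
    also have "(\<Sum>i<e. r i * t ^ Suc i) = (\<Sum>i<Suc e. (if i = 0 then 0 else r (i - 1)) * t ^ i)"
      by (simp add: sum.lessThan_Suc_shift del: sum.lessThan_Suc)
    also have "r e * t ^ Suc e = (\<Sum>i<Suc e. r e * c i * t ^ i)"
      unfolding t(1) by (simp only: sum_distrib_left mult.assoc)
    finally have "t * x = (\<Sum>i<Suc e. s i * t ^ i)"
      unfolding s_def distrib_right sum.distrib .
    moreover have "\<forall>i. s i \<in> R" unfolding s_def using r(1) t(2) by (auto intro!: Rs)
    ultimately show ?thesis unfolding R'_def by blast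
  qed
  have mtp: "t ^ i * x \<in> R'" if "x \<in> R'" for x i
    by (induction i) (use that mt in \<open>auto simp: mult.assoc\<close>)
  have zero: "0 \<in> R'" and one: "1 \<in> R'" using sub Rs by auto
  have sums: "sum f A \<in> R'" if "\<And>i. i \<in> A \<Longrightarrow> f i \<in> R'" for f and A :: "nat set"
    using that by (induction A rule: infinite_finite_induct) (auto simp: zero add)
  have mult: "x * y \<in> R'" if xy: "x \<in> R'" "y \<in> R'" for x y
  proof -
    from xy obtain r where r: "\<forall>i. r i \<in> R" "x = (\<Sum>i<Suc e. r i * t ^ i)" unfolding R'_def by blast
    have "x * y = (\<Sum>i<Suc e. r i * (t ^ i * y))" unfolding r(2) by (simp only: sum_distrib_right mult.assoc)
    also have "\<dots> \<in> R'" using r(1) xy(2) by (intro sums scale mtp) auto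
    finally show ?thesis .
  qed
  have minus: "x - y \<in> R'" if "x \<in> R'" "y \<in> R'" for x y
    using add[OF that(1) scale[OF that(2) Rs(6)[OF Rs(1)]]] by simp
  have "subring_on R'" unfolding subring_on_def by (intro conjI ballI one add minus mult)
  moreover have "t \<in> R'" using mt[OF one] by simp
  moreover define G' where "G' = (\<lambda>(g, i). g * t ^ i) ` (G \<times> {..<Suc e})"
  have "finite G'" unfolding G'_def using G(1) by blast
  moreover have "R' \<subseteq> Z.span G'"
  proof
    fix x assume "x \<in> R'"
    then obtain r where r: "\<forall>i. r i \<in> R" "x = (\<Sum>i<Suc e. r i * t ^ i)" unfolding R'_def by blast
    have "y * t ^ i \<in> Z.span G'" if "y \<in> Z.span G" "i < Suc e" for y i
      using that(1)
    proof (induction rule: Z.span_induct_alt)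
      case base
      then show ?case using Z.span_zero by simp
    next
      case (step c g y)
      have "g * t ^ i \<in> G'" using step(1) that(2) unfolding G'_def by auto
      then have "of_int c * (g * t ^ i) + y * t ^ i \<in> Z.span G'"
        by (intro Z.span_add Z.span_scale step Z.span_base)
      then show ?case by (simp add: algebra_simps)
    qed
    then show "x \<in> Z.span G'" unfolding r(2) using r(1) G(2) by (intro Z.span_sum) auto
  qed
  ultimately show ?thesis using that sub by blast
qed

section \<open>Congruences inside a subring and elimination of approximate roots of unity\<close>

definition dvd_in :: "complex set \<Rightarrow> complex \<Rightarrow> complex \<Rightarrow> bool" where
  "dvd_in R q z \<longleftrightarrow> (\<exists>w\<in>R. z = q * w)"

lemma dvd_in_0: "subring_on R \<Longrightarrow> dvd_in R q 0"
  unfolding dvd_in_def by (rule bexI[of _ 0]) (simp_all add: subring_onD(2))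

lemma dvd_in_add: "subring_on R \<Longrightarrow> dvd_in R q x \<Longrightarrow> dvd_in R q y \<Longrightarrow> dvd_in R q (x + y)"
  unfolding dvd_in_def by (auto simp: distrib_left[symmetric] intro: subring_onD(3))

lemma dvd_in_diff: "subring_on R \<Longrightarrow> dvd_in R q x \<Longrightarrow> dvd_in R q y \<Longrightarrow> dvd_in R q (x - y)"
  unfolding dvd_in_def by (auto simp: right_diff_distrib[symmetric] intro: subring_onD(4))

lemma dvd_in_mult: "subring_on R \<Longrightarrow> dvd_in R q x \<Longrightarrow> y \<in> R \<Longrightarrow> dvd_in R q (x * y)"
  unfolding dvd_in_def by (auto simp: mult.assoc intro: subring_onD(5))

lemma dvd_in_mult_mono:
  assumes "subring_on R" "dvd_in R q x" "dvd_in R q' x'"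
  shows "dvd_in R (q * q') (x * x')"
proof -
  from assms obtain w w' where "w \<in> R" "x = q * w" "w' \<in> R" "x' = q' * w'" unfolding dvd_in_def by blast
  then show ?thesis unfolding dvd_in_def using subring_onD(5)[OF assms(1)]
    by (intro bexI[of _ "w * w'"]) auto
qed

lemma roots_of_unity_product:
  assumes "N > 0"
  shows "(\<Prod>\<xi> | \<xi> ^ N = 1. z - \<xi>) = z ^ N - (1::complex)"
proof -
  define P :: "complex poly" where "P = monom 1 N + [:-1:]"
  have poly: "poly P x = x ^ N - 1" for x by (simp add: P_def poly_monom)
  have dP: "degree P = N" unfolding P_def using assms
    by (subst degree_add_eq_left) (auto simp: degree_monom_eq)
  then have "P \<noteq> 0" using assms by auto
  have lc: "lead_coeff P = 1" unfolding dP using assms by (simp add: P_def coeff_pCons split: nat.split)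
  have "rsquarefree P" unfolding rsquarefree_roots
    using assms by (auto simp: poly P_def power_0_left pderiv_add pderiv_pCons pderiv_monom poly_monom)
  from complex_poly_decompose_rsquarefree[OF this]
  have "P = (\<Prod>z | poly P z = 0. [:- z, 1:])" using lc by simp
  then have "poly P z = poly (\<Prod>z | poly P z = 0. [:- z, 1:]) z" by (rule arg_cong)
  also have "\<dots> = (\<Prod>\<xi> | poly P \<xi> = 0. z - \<xi>)" by (simp add: poly_prod)
  finally have "poly P z = (\<Prod>\<xi> | poly P \<xi> = 0. z - \<xi>)" .
  then show ?thesis by (simp add: poly)
qed

lemma prod_cong_mod:
  assumes R: "subring_on R" and "finite A" "\<And>i. i \<in> A \<Longrightarrow> f i \<in> R \<and> g i \<in> R \<and> dvd_in R q (f i - g i)"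
  shows "dvd_in R q (prod f A - prod g A)"
  using assms(2,3)
proof (induction A rule: finite_induct)
  case empty
  then show ?case by (simp add: dvd_in_0[OF R])
next
  case (insert x A)
  have "prod f (insert x A) - prod g (insert x A) = (f x - g x) * prod f A + (prod f A - prod g A) * g x"
    using insert by (simp add: algebra_simps)
  also have "dvd_in R q \<dots>"
    using insert by (intro dvd_in_add dvd_in_mult R) (auto intro!: subring_on_prod[OF R])
  finally show ?case .
qed

text \<open>Congruence of products with the modulus \<open>d\<close> itself; taken with
  \<open>d = e - \<xi>\<close> it supplies the divided differences that the elimination
  requires.\<close>

lemma divided_difference_prod:
  assumes R: "subring_on R" and "finite A" "\<And>i. i \<in> A \<Longrightarrow> f i \<in> R \<and> g i \<in> R \<and> (\<exists>h\<in>R. f i - g i = d * h)"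
  shows "\<exists>h\<in>R. prod f A - prod g A = d * h"
  using prod_cong_mod[of R A f g d] assms unfolding dvd_in_def by blast

text \<open>Eliminates an approximate root of unity: modulo \<open>q\<close>, both \<open>\<Prod>(g e - g \<xi>)\<close> and \<open>e ^ N - 1\<close> vanish,
  while the former is congruent to \<open>\<Prod>(- g \<xi>)\<close>.\<close>

lemma roots_of_unity_elimination:
  assumes R: "subring_on R" and N: "N > 0" and roots: "\<And>\<xi>. \<xi> ^ N = 1 \<Longrightarrow> \<xi> \<in> R"
    and e: "dvd_in R q (e ^ N - 1)" "dvd_in R q (g e)" "e \<in> R" "g e \<in> R"
    and g: "\<And>\<xi>. \<xi> ^ N = 1 \<Longrightarrow> g \<xi> \<in> R \<and> (\<exists>h\<in>R. g e - g \<xi> = (e - \<xi>) * h)"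
  shows "dvd_in R q (\<Prod>\<xi> | \<xi> ^ N = 1. g \<xi>)"
proof -
  let ?A = "{\<xi>::complex. \<xi> ^ N = 1}"
  have fin: "finite ?A" using finite_roots_unity[of N] N by simp
  from g obtain h where h: "\<And>\<xi>. \<xi> \<in> ?A \<Longrightarrow> h \<xi> \<in> R \<and> g e - g \<xi> = (e - \<xi>) * h \<xi>" unfolding mem_Collect_eq by metis
  have "(\<Prod>\<xi>\<in>?A. g e - g \<xi>) = (e ^ N - 1) * prod h ?A"
    using h unfolding roots_of_unity_product[OF N, symmetric] prod.distrib[symmetric] by (intro prod.cong) auto
  also have "dvd_in R q \<dots>" using h by (intro dvd_in_mult R e subring_on_prod) auto
  finally have 1: "dvd_in R q (\<Prod>\<xi>\<in>?A. g e - g \<xi>)" .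
  have "dvd_in R q ((\<Prod>\<xi>\<in>?A. g e - g \<xi>) - (\<Prod>\<xi>\<in>?A. - g \<xi>))"
    using g e by (intro prod_cong_mod R fin) (auto intro: subring_onD[OF R])
  from dvd_in_diff[OF R 1 this] have "dvd_in R q (\<Prod>\<xi>\<in>?A. - g \<xi>)" by simp
  then have "dvd_in R q ((-1) ^ card ?A * (\<Prod>\<xi>\<in>?A. g \<xi>))" by (simp add: prod_uminus)
  from dvd_in_mult[OF R this, of "(-1) ^ card ?A"] show ?thesis
    using subring_on_power[OF R, of "-1"] subring_onD[OF R] by (simp add: ac_simps power_mult_distrib[symmetric])
qed

text \<open>Two eliminations: first of \<open>f\<close> with \<open>e\<close> held fixed, then of
  \<open>e\<close> in the resulting product over \<open>\<eta>\<close>.\<close>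

lemma twisted_sum_product:
  assumes R: "subring_on R" and N: "N > 0" and roots: "\<And>\<xi>. \<xi> ^ N = 1 \<Longrightarrow> \<xi> \<in> R"
    and B: "B1 \<in> R" "B2 \<in> R" "B3 \<in> R" "e \<in> R" "f \<in> R"
    and ef: "dvd_in R q (e ^ N - 1)" "dvd_in R q (f ^ N - 1)" "dvd_in R q (B1 + B2 * e + B3 * f)"
  shows "dvd_in R q (\<Prod>\<xi> | \<xi> ^ N = 1. \<Prod>\<eta> | \<eta> ^ N = 1. B1 + B2 * \<xi> + B3 * \<eta>)"
proof -
  have fin: "finite {\<xi>::complex. \<xi> ^ N = 1}" using finite_roots_unity[of N] N by simp
  note Rs = subring_onD[OF R]
  have 1: "dvd_in R q (\<Prod>\<eta> | \<eta> ^ N = 1. B1 + B2 * e + B3 * \<eta>)"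
  proof (rule roots_of_unity_elimination[OF R N roots ef(2), of "\<lambda>\<eta>. B1 + B2 * e + B3 * \<eta>"])
    show "B1 + B2 * e + B3 * \<xi> \<in> R \<and> (\<exists>h\<in>R. B1 + B2 * e + B3 * f - (B1 + B2 * e + B3 * \<xi>) = (f - \<xi>) * h)"
      if "\<xi> ^ N = 1" for \<xi>
      using B roots[OF that] by (intro conjI bexI[of _ B3] Rs) (auto simp: algebra_simps)
  qed (use B ef in \<open>auto intro!: Rs\<close>)
  show ?thesis
  proof (rule roots_of_unity_elimination[OF R N roots ef(1), of "\<lambda>\<xi>. \<Prod>\<eta> | \<eta> ^ N = 1. B1 + B2 * \<xi> + B3 * \<eta>"])
    show "(\<Prod>\<eta> | \<eta> ^ N = 1. B1 + B2 * \<xi> + B3 * \<eta>) \<in> R \<and>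
        (\<exists>h\<in>R. (\<Prod>\<eta> | \<eta> ^ N = 1. B1 + B2 * e + B3 * \<eta>) - (\<Prod>\<eta> | \<eta> ^ N = 1. B1 + B2 * \<xi> + B3 * \<eta>) = (e - \<xi>) * h)"
      if xi: "\<xi> ^ N = 1" for \<xi>
    proof (intro conjI divided_difference_prod R fin subring_on_prod)
      fix \<eta> :: complex assume "\<eta> \<in> {\<eta>. \<eta> ^ N = 1}"
      then have h: "\<eta> \<in> R" using roots by blast
      then show "B1 + B2 * \<xi> + B3 * \<eta> \<in> R" "B1 + B2 * e + B3 * \<eta> \<in> R" "B1 + B2 * \<xi> + B3 * \<eta> \<in> R"
        using B roots[OF xi] by (auto intro!: Rs)
      show "\<exists>h\<in>R. B1 + B2 * e + B3 * \<eta> - (B1 + B2 * \<xi> + B3 * \<eta>) = (e - \<xi>) * h"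
        using B by (intro bexI[of _ B2]) (auto simp: algebra_simps)
    qed
  qed (use B ef 1 roots in \<open>auto intro!: Rs subring_on_prod[OF R]\<close>)
qed

text \<open>Each \<open>p\<close>-th power gains a factor \<open>p\<close>: \<open>y ^ p - 1\<close>
  is \<open>y - 1\<close> times the sum of the \<open>y ^ i\<close> with \<open>i < p\<close>, and
  for \<open>y\<close> congruent to 1 this sum is congruent to \<open>p\<close>, hence to 0, modulo
  \<open>p\<close>.\<close>

lemma one_unit_power_prime:
  assumes R: "subring_on R" and x: "x \<in> R" "dvd_in R (of_nat p) (x - 1)"
  shows "dvd_in R (of_nat p ^ Suc k) (x ^ (p ^ k) - 1)"
proof (induction k)
  case 0
  then show ?case using x by simp
next
  case (Suc k)
  define y where "y = x ^ (p ^ k)"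
  have y: "y \<in> R" unfolding y_def by (rule subring_on_power[OF R x(1)])
  from Suc obtain w where w: "w \<in> R" "y - 1 = of_nat p ^ Suc k * w" unfolding dvd_in_def y_def by blast
  have d: "dvd_in R (of_nat p) (y - 1)" unfolding dvd_in_def using w subring_onD[OF R]
    by (intro bexI[of _ "of_nat p ^ k * w"]) (auto intro!: subring_onD[OF R] subring_on_power[OF R] subring_on_of_nat[OF R])
  have "dvd_in R (of_nat p) (\<Sum>i<p. y ^ i)"
  proof -
    have "dvd_in R (of_nat p) (y ^ i - 1)" for i
      using prod_cong_mod[OF R, of "{..<i}" "\<lambda>_. y" "\<lambda>_. 1"] y d subring_onD(1)[OF R] by auto
    then have "dvd_in R (of_nat p) (\<Sum>i\<in>A. y ^ i - 1)" for A :: "nat set"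
      by (induction A rule: infinite_finite_induct) (auto intro: dvd_in_add[OF R] dvd_in_0[OF R])
    from dvd_in_add[OF R this[of "{..<p}"], of "of_nat p"] subring_onD(1)[OF R]
    show ?thesis by (auto simp: sum_subtractf dvd_in_def)
  qed
  from dvd_in_mult_mono[OF R Suc this]
  have "dvd_in R (of_nat p ^ Suc k * of_nat p) ((y - 1) * (\<Sum>i<p. y ^ i))" unfolding y_def .
  moreover have "(y - 1) * (\<Sum>i<p. y ^ i) = y ^ p - 1" by (simp add: power_diff_1_eq)
  ultimately show ?case unfolding y_def by (simp add: power_mult[symmetric] ac_simps)
qed

section \<open>The twisted relation between the roots\<close>

lemma recurs_power_int:
  fixes l :: "'a::field"
  assumes "l ^ 3 = 2 * l ^ 2 + of_int b * l + 1" "l \<noteq> 0"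
  shows "recurs b (\<lambda>n. l powi n)"
proof -
  have e: "l powi (n + 3) = l powi n * l ^ 3" "l powi (n + 2) = l powi n * l ^ 2"
      "l powi (n + 1) = l powi n * l" for n
    using assms(2) by (simp_all add: power_int_add)
  show ?thesis unfolding recurs_def e assms(1) by (simp add: algebra_simps)
qed

lemma subring_on_power_int:
  assumes R: "subring_on R" and y: "y \<in> R" "inverse y \<in> R"
  shows "y powi t \<in> R"
  unfolding power_int_def using y by (auto intro: subring_on_power[OF R])

lemma one_unit_power_int:
  assumes R: "subring_on R" and y: "y \<in> R" "inverse y \<in> R" "y \<noteq> 0" "dvd_in R q (y - 1)"
  shows "dvd_in R q (y powi t - 1)"
proof -
  have nat: "dvd_in R q (z ^ n - 1)" if "z \<in> R" "dvd_in R q (z - 1)" for z n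
    using prod_cong_mod[OF R, of "{..<n}" "\<lambda>_. z" "\<lambda>_. 1"] that subring_onD(1)[OF R] by auto
  have "dvd_in R q ((y - 1) * (- inverse y))"
    using y subring_onD(6)[OF R] by (intro dvd_in_mult[OF R]) auto
  moreover have "(y - 1) * (- inverse y) = inverse y - 1" using y(3) by (simp add: algebra_simps)
  ultimately have "dvd_in R q (inverse y - 1)" by simp
  then show ?thesis unfolding power_int_def using nat y by auto
qed

locale tripell_roots = tripell_seq +
  fixes l1 l2 l3 :: complex
  assumes e1: "l1 + l2 + l3 = 2" and e2: "l1 * l2 + l1 * l3 + l2 * l3 = - of_int b" and e3: "l1 * l2 * l3 = 1"
begin

lemma roots_nonzero: "l1 \<noteq> 0" "l2 \<noteq> 0" "l3 \<noteq> 0"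
  using e3 by auto

lemma roots_cubic: "l1 ^ 3 = 2 * l1 ^ 2 + of_int b * l1 + 1" "l2 ^ 3 = 2 * l2 ^ 2 + of_int b * l2 + 1"
  "l3 ^ 3 = 2 * l3 ^ 2 + of_int b * l3 + 1"
proof -
  have l: "2 * l ^ 2 + of_int b * l + 1 = (l1 + l2 + l3) * l ^ 2 - (l1 * l2 + l1 * l3 + l2 * l3) * l + l1 * l2 * l3" for l
    unfolding e1 e2 e3 by simp
  show "l1 ^ 3 = 2 * l1 ^ 2 + of_int b * l1 + 1" "l2 ^ 3 = 2 * l2 ^ 2 + of_int b * l2 + 1"
    "l3 ^ 3 = 2 * l3 ^ 2 + of_int b * l3 + 1"
    unfolding l by (simp_all add: power2_eq_square power3_eq_cube algebra_simps)
qed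

lemma roots_inverse: "inverse l1 = l2 * l3" "inverse l2 = l1 * l3" "inverse l3 = l1 * l2"
  using e3 by (auto intro!: inverse_unique simp: ac_simps)

lemmas roots_recurs = recurs_power_int[OF roots_cubic(1) roots_nonzero(1)]
  recurs_power_int[OF roots_cubic(2) roots_nonzero(2)] recurs_power_int[OF roots_cubic(3) roots_nonzero(3)]

lemma power_int_expand:
  assumes "l \<in> {l1, l2, l3}"
  shows "l powi n = of_int (X (n - 1)) * l ^ 2 + of_int (X n - 2 * X (n - 1)) * l + of_int (X (n - 2))"
proof -
  have "recurs b (\<lambda>n. l powi n)" using assms roots_recurs by auto
  from recurs_addition[OF this, of 0 n] show ?thesis by simp
qed

text \<open>The Vandermonde product \<open>(l1 - l2) * (l1 - l3) * (l2 - l3)\<close>.\<close>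

definition delta :: complex where
  "delta = l1 ^ 2 * (l2 - l3) + l2 ^ 2 * (l3 - l1) + l3 ^ 2 * (l1 - l2)"

text \<open>Binet's formula with denominators cleared: the combination on the left takes the values
  0, 0, \<open>delta\<close> at the exponents 0, 1, 2.\<close>

lemma binet: "l1 powi (n + 1) * (l2 - l3) + l2 powi (n + 1) * (l3 - l1) + l3 powi (n + 1) * (l1 - l2)
  = of_int (X n) * delta"
proof -
  have "recurs b (\<lambda>n. l1 powi n * (l2 - l3) + l2 powi n * (l3 - l1) + l3 powi n * (l1 - l2))"
    by (intro recurs_add recurs_scale roots_recurs)
  from recurs_addition[OF this, of 0 "n + 1"] show ?thesis
    by (simp add: delta_def) (simp add: algebra_simps)
qed

end

text \<open>\<open>l1\<close>, \<open>l2\<close> and a primitive \<open>N\<close>-th root of unity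
  are adjoined to the integers in turn, each by a monic relation.\<close>

lemma algebraic_subring_exists:
  fixes l1 l2 :: complex
  assumes l: "l1 ^ 3 = 2 * l1 ^ 2 + of_int b * l1 + 1" "l2 ^ 3 = 2 * l2 ^ 2 + of_int b * l2 + 1" and N: "N > 0"
  obtains R G where "subring_on R" "finite G" "R \<subseteq> Z.span G" "l1 \<in> R" "l2 \<in> R" "\<And>\<xi>. \<xi> ^ N = 1 \<Longrightarrow> \<xi> \<in> R"
proof -
  define c :: "nat \<Rightarrow> complex" where "c = (\<lambda>i. if i = 0 then 1 else if i = 1 then of_int b else 2)"
  have c: "c i \<in> R" if "subring_on R" for R i
    using subring_on_of_int[OF that, of 1] subring_on_of_int[OF that, of b] subring_on_of_int[OF that, of 2]
    by (auto simp: c_def)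
  have t: "t ^ Suc 2 = (\<Sum>i<Suc 2. c i * t ^ i)" if "t ^ 3 = 2 * t ^ 2 + of_int b * t + 1" for t
    using that by (simp add: c_def numeral_3_eq_3 numeral_2_eq_2)
  obtain R1 G1 where 1: "subring_on R1" "\<int> \<subseteq> R1" "l1 \<in> R1" "finite G1" "R1 \<subseteq> Z.span G1"
    using subring_on_adjoin_integral[OF subring_on_Ints(1) _ subring_on_Ints(2) t[OF l(1)] c[OF subring_on_Ints(1)]]
    by blast
  obtain R2 G2 where 2: "subring_on R2" "R1 \<subseteq> R2" "l2 \<in> R2" "finite G2" "R2 \<subseteq> Z.span G2"
    using subring_on_adjoin_integral[OF 1(1,4,5) t[OF l(2)] c[OF 1(1)]] by blast
  obtain M where M: "N = Suc M" using N by (cases N) auto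
  define w where "w = exp (2 * of_real pi * \<i> / of_nat N)"
  have w: "w ^ j = exp (2 * of_real pi * \<i> * of_nat j / of_nat N)" for j
    unfolding w_def exp_of_nat_mult[symmetric] by (simp add: ac_simps)
  have "w ^ N = 1" unfolding w using N by simp
  then have "w ^ Suc M = (\<Sum>i<Suc M. (if i = 0 then 1 else 0) * w ^ i)"
    unfolding M by (simp add: sum.lessThan_Suc_shift del: sum.lessThan_Suc power_Suc)
  moreover have "(if i = 0 then 1 else 0) \<in> R2" for i :: nat using subring_onD[OF 2(1)] by simp
  ultimately obtain R3 G3 where 3: "subring_on R3" "R2 \<subseteq> R3" "w \<in> R3" "finite G3" "R3 \<subseteq> Z.span G3"
    by (rule subring_on_adjoin_integral[OF 2(1,4,5)])
  have "\<xi> \<in> R3" if "\<xi> ^ N = 1" for \<xi>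
  proof -
    from that obtain j where "\<xi> = w ^ j" unfolding w using complex_roots_unity[of N] N by auto
    then show ?thesis using subring_on_power[OF 3(1,3)] by simp
  qed
  then show ?thesis using that[OF 3(1,4,5)] 1 2 3 by blast
qed

text \<open>For \<open>n\<close> near \<open>a\<close> with \<open>X n\<close> near 0, the quotients
  \<open>(l2 / l1) powi (n - a)\<close> and \<open>(l3 / l1) powi (n - a)\<close> are
  \<open>N\<close>-th roots of unity and satisfy the twisted relation, both up to
  \<open>p ^ m\<close>. Hence \<open>W\<close>, the product of all twisted sums, is divisible by
  every \<open>p ^ m\<close> in one finitely generated ring; it is 0, and some factor
  vanishes.\<close>

lemma (in tripell_roots) twisted_vanishing:
  assumes per: "tripell_period b X p N"
    and lim: "\<And>m. \<exists>n. int p ^ m dvd n - a \<and> int p ^ m dvd X n"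
  obtains \<xi> \<eta> where "\<xi> ^ N = 1" "\<eta> ^ N = 1" "l1 powi (a + 1) * (l2 - l3) + \<xi> * (l2 powi (a + 1) * (l3 - l1))
    + \<eta> * (l3 powi (a + 1) * (l1 - l2)) = 0"
proof -
  interpret tripell_period b X p N by fact
  obtain R G where R: "subring_on R" "finite G" "R \<subseteq> Z.span G" "l1 \<in> R" "l2 \<in> R"
    and roots: "\<And>\<xi>. \<xi> ^ N = 1 \<Longrightarrow> \<xi> \<in> R"
    using algebraic_subring_exists[OF roots_cubic(1,2) N_pos] by blast
  note Rs = subring_onD[OF R(1)]
  have l3: "l3 \<in> R"
  proof -
    have "of_int 2 - l1 - l2 \<in> R" by (intro Rs R subring_on_of_int)
    moreover have "l3 = of_int 2 - l1 - l2" using e1 by (simp add: algebra_simps eq_diff_eq)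
    ultimately show ?thesis by simp
  qed
  have inv: "inverse l1 \<in> R" "inverse l2 \<in> R" "inverse l3 \<in> R"
    unfolding roots_inverse using R l3 by (auto intro: Rs)
  \<comment> \<open>The period congruences, read in \<open>R\<close> through
    \<open>power_int_expand\<close>.\<close>
  have lN: "dvd_in R (of_nat p) (l ^ N - 1)" if l: "l \<in> {l1, l2, l3}" for l
  proof -
    have lR: "l \<in> R" using l R l3 by auto
    have "int p dvd X (int N - 1)" "int p dvd X N" "int p dvd X (int N - 2) - 1"
      using period by (auto simp: cong_iff_dvd_diff)
    then obtain u v w :: int where uvw: "X (int N - 1) = p * u" "X N = p * v" "X (int N - 2) - 1 = p * w"
      unfolding dvd_def by auto
    have "l ^ N - 1 = of_int (X (int N - 1)) * l ^ 2 + of_int (X N - 2 * X (int N - 1)) * l + of_int (X (int N - 2) - 1)"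
      using power_int_expand[OF l, of N] by simp
    also have "\<dots> = of_nat p * (of_int u * l ^ 2 + of_int (v - 2 * u) * l + of_int w)"
      unfolding uvw by (simp add: algebra_simps)
    finally show ?thesis unfolding dvd_in_def using R(1) lR
      by (intro bexI[of _ "of_int u * l ^ 2 + of_int (v - 2 * u) * l + of_int w"])
        (auto intro!: Rs subring_on_of_int subring_on_power simp del: of_int_diff)
  qed
  define W where "W = (\<Prod>\<xi> | \<xi> ^ N = 1. \<Prod>\<eta> | \<eta> ^ N = 1. l1 powi (a + 1) * (l2 - l3)
     + l2 powi (a + 1) * (l3 - l1) * \<xi> + l3 powi (a + 1) * (l1 - l2) * \<eta>)"
  have "dvd_in R (of_nat p ^ m) W" for m
  proof -
    obtain n where n: "int p ^ m dvd n - a" "int p ^ m dvd X n" using lim by blast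
    from n(1) obtain t where t: "n - a = int p ^ m * t" by blast
    from n(2) obtain s where s: "X n = int p ^ m * s" by blast
    \<comment> \<open>For \<open>u = l / l1\<close> the power \<open>u ^ N\<close> is 1 modulo
      \<open>p\<close>, so its \<open>p ^ m\<close>-th power is 1 modulo \<open>p ^ m\<close>; and
      \<open>n - a\<close> is a multiple of \<open>p ^ m\<close>.\<close>
    have quot: "l / l1 \<in> R \<and> inverse (l / l1) \<in> R \<and> (l / l1) powi (n - a) \<in> R \<and>
        dvd_in R (of_nat p ^ m) (((l / l1) powi (n - a)) ^ N - 1)" if l: "l \<in> {l2, l3}" for l
    proof -
      have l0: "l \<noteq> 0" and lR: "l \<in> R" "inverse l \<in> R" using l roots_nonzero R l3 inv by auto
      define u where "u = l / l1"
      have u: "u \<in> R" "inverse u \<in> R" "u \<noteq> 0" using lR R inv l0 roots_nonzero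
        unfolding u_def divide_inverse by (auto simp: intro!: Rs)
      have "dvd_in R (of_nat p) ((l ^ N - 1) * inverse l1 ^ N - (l1 ^ N - 1) * inverse l1 ^ N)"
        using l by (intro dvd_in_diff[OF R(1)] dvd_in_mult[OF R(1)] lN subring_on_power[OF R(1)] inv(1)) auto
      moreover have "(l ^ N - 1) * inverse l1 ^ N - (l1 ^ N - 1) * inverse l1 ^ N = u ^ N - 1"
        using roots_nonzero by (simp add: u_def divide_simps)
      ultimately have "dvd_in R (of_nat p) (u ^ N - 1)" by simp
      from one_unit_power_prime[OF R(1) subring_on_power[OF R(1) u(1)] this, of m]
      have "dvd_in R (of_nat p ^ Suc m) ((u ^ N) ^ (p ^ m) - 1)" .
      then have "dvd_in R (of_nat p ^ m) ((u ^ N) ^ (p ^ m) - 1)"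
        unfolding dvd_in_def using Rs(5)[OF subring_on_of_nat[OF R(1)]]
        by (metis mult.assoc mult.commute power_Suc)
      then have "dvd_in R (of_nat p ^ m) (((u ^ N) ^ (p ^ m)) powi t - 1)"
        using u by (intro one_unit_power_int R subring_on_power) (auto simp: power_inverse[symmetric] intro!: subring_on_power R)
      also have "((u ^ N) ^ (p ^ m)) powi t = u powi (int N * int (p ^ m) * t)"
        unfolding power_int_mult power_int_of_nat ..
      also have "\<dots> = u powi ((n - a) * int N)" unfolding t by (simp add: ac_simps)
      also have "\<dots> = (u powi (n - a)) ^ N" unfolding power_int_mult power_int_of_nat ..
      finally show ?thesis using u subring_on_power_int[OF R(1) u(1,2)] unfolding u_def by blast
    qed
    \<comment> \<open>Turns the twisted sum at \<open>a\<close> into \<open>l1 powi (a - n)\<close>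
      times the Binet sum at \<open>n\<close>.\<close>
    have e: "l powi (a + 1) * (l / l1) powi (n - a) = l1 powi (a - n) * l powi (n + 1)"
      if "l \<in> {l1, l2, l3}" for l
    proof -
      have "l \<noteq> 0" using that roots_nonzero by auto
      have "l1 powi (n - a) * l1 powi (a - n) = 1" using roots_nonzero by (simp add: power_int_add[symmetric])
      moreover have "l powi (n + 1) = l powi (a + 1) * l powi (n - a)"
        using \<open>l \<noteq> 0\<close> by (simp add: power_int_add[symmetric] add.commute)
      moreover have "l1 powi (n - a) \<noteq> 0" using roots_nonzero by simp
      ultimately show ?thesis by (simp add: power_int_divide_distrib field_simps)
    qed
    have "l1 powi (a + 1) * (l2 - l3) + l2 powi (a + 1) * (l3 - l1) * (l2 / l1) powi (n - a)
        + l3 powi (a + 1) * (l1 - l2) * (l3 / l1) powi (n - a)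
      = l1 powi (a - n) * (l1 powi (n + 1) * (l2 - l3) + l2 powi (n + 1) * (l3 - l1) + l3 powi (n + 1) * (l1 - l2))"
      using e[of l1] e[of l2] e[of l3] roots_nonzero by (simp add: algebra_simps)
    also have "\<dots> = of_nat p ^ m * (l1 powi (a - n) * of_int s * delta)"
      unfolding binet s by simp
    finally have *: "dvd_in R (of_nat p ^ m) (l1 powi (a + 1) * (l2 - l3) + l2 powi (a + 1) * (l3 - l1) * (l2 / l1) powi (n - a)
        + l3 powi (a + 1) * (l1 - l2) * (l3 / l1) powi (n - a))"
      unfolding dvd_in_def delta_def using R inv l3
      by (intro bexI[of _ "l1 powi (a - n) * of_int s * (l1 ^ 2 * (l2 - l3) + l2 ^ 2 * (l3 - l1) + l3 ^ 2 * (l1 - l2))"]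
        Rs subring_on_power subring_on_power_int subring_on_of_int)
    show ?thesis unfolding W_def
      by (rule twisted_sum_product[OF R(1) N_pos roots _ _ _ _ _ _ _ *])
        (use quot[of l2] quot[of l3] in \<open>simp_all add: Rs subring_on_power_int R l3 inv\<close>)
  qed
  then have "\<exists>w\<in>Z.span G. W = of_nat p ^ m * w" for m
    using R(3) unfolding dvd_in_def by (meson subsetD)
  then have "W = 0" using infinitely_divisible_eq_zero[OF R(2), of p W] p(2) by simp
  moreover have "finite {\<xi>::complex. \<xi> ^ N = 1}" using finite_roots_unity[of N] N_pos by simp
  ultimately obtain \<xi> \<eta> where "\<xi> ^ N = 1" "\<eta> ^ N = 1" "l1 powi (a + 1) * (l2 - l3)
     + l2 powi (a + 1) * (l3 - l1) * \<xi> + l3 powi (a + 1) * (l1 - l2) * \<eta> = 0"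
    unfolding W_def by (auto simp: prod_zero_iff)
  then show ?thesis using that by (auto simp: ac_simps)
qed

section \<open>The Galois action on the roots\<close>

lemma square_eq_times_square_imp_zero:
  fixes x y :: int
  assumes q: "prime q" and d: "multiplicity q d = 1" and eq: "x ^ 2 = d * y ^ 2"
  shows "y = 0"
proof (rule ccontr)
  assume y: "y \<noteq> 0"
  have "d \<noteq> 0" using d by auto
  then have "x \<noteq> 0" using y eq by auto
  have "2 * multiplicity q x = 1 + 2 * multiplicity q y"
    using arg_cong[OF eq, of "multiplicity q"] prime_imp_prime_elem[OF q] d y \<open>x \<noteq> 0\<close> \<open>d \<noteq> 0\<close>
    by (simp add: power2_eq_square prime_elem_multiplicity_mult_distrib)
  then show False by presburger
qed

lemma rat_square_eq_times_square_imp_zero: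
  fixes x y :: rat and d q :: int
  assumes q: "prime q" and d: "multiplicity q d = 1" and eq: "x ^ 2 = of_int d * y ^ 2"
  shows "y = 0"
proof -
  obtain u v where uv: "x = of_int u / of_int v" "v > 0"
    using quotient_of_denom_pos quotient_of_div by (cases "quotient_of x") blast
  obtain s t where st: "y = of_int s / of_int t" "t > 0"
    using quotient_of_denom_pos quotient_of_div by (cases "quotient_of y") blast
  have "of_int ((u * t) ^ 2) = (of_int (d * (s * v) ^ 2) :: rat)"
    using eq uv st by (simp add: field_simps power2_eq_square)
  then have "(u * t) ^ 2 = d * (s * v) ^ 2" by (simp only: of_int_eq_iff)
  from square_eq_times_square_imp_zero[OF q d this] show ?thesis using uv st by simp
qed

lemma cubic_no_rational_root:
  fixes t :: rat and b :: int
  assumes b: "b = 1 \<or> b = 2"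
  shows "t ^ 3 \<noteq> 2 * t ^ 2 + of_int b * t + 1"
proof
  assume t: "t ^ 3 = 2 * t ^ 2 + of_int b * t + 1"
  obtain u v where uv: "quotient_of t = (u, v)" by (cases "quotient_of t")
  then have v: "v > 0" "coprime u v" "t = of_int u / of_int v"
    using quotient_of_denom_pos quotient_of_coprime quotient_of_div by blast+
  have "of_int (u ^ 3) = (of_int (2 * u ^ 2 * v + b * u * v ^ 2 + v ^ 3) :: rat)"
    using t v by (simp add: field_simps power2_eq_square power3_eq_cube)
  then have "u ^ 3 = 2 * u ^ 2 * v + b * u * v ^ 2 + v ^ 3" by (simp only: of_int_eq_iff)
  then have e: "u ^ 3 = v * (2 * u ^ 2 + b * u * v + v ^ 2)" by (simp add: algebra_simps power2_eq_square power3_eq_cube)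
  then have "v dvd u ^ 3" by simp
  moreover have "coprime v (u ^ 3)" using v(2) by (simp add: coprime_commute)
  ultimately have "v dvd 1" using coprime_common_divisor[of v "u ^ 3" v] by simp
  then have "v = 1" using v(1) by simp
  then have "u * (u * u - 2 * u - b) = 1" using e by (simp add: algebra_simps power2_eq_square power3_eq_cube)
  then have "u = 1 \<or> u = -1" using zmult_eq_1_iff by blast
  then show False using \<open>u * (u * u - 2 * u - b) = 1\<close> b by auto
qed

text \<open>The intermediate value theorem gives a root \<open>r\<close> in [2, 3]. The other two
  have sum \<open>2 - r\<close> and product \<open>1 / r\<close>; they are not real because
  \<open>(1 - r / 2) ^ 2 \<le> 1 / 4 < 1 / r\<close>.\<close>

lemma cubic_roots_exist:
  fixes b :: int
  assumes b: "b = 1 \<or> b = 2"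
  obtains r :: real and z :: complex where "of_real r + z + cnj z = 2"
    "of_real r * z + of_real r * cnj z + z * cnj z = - of_int b" "of_real r * z * cnj z = 1"
    "Im z \<noteq> 0"
proof -
  define f where "f = (\<lambda>r::real. r ^ 3 - 2 * r ^ 2 - of_int b * r - 1)"
  have "\<exists>r. 2 \<le> r \<and> r \<le> 3 \<and> f r = 0"
    by (rule IVT') (use b in \<open>auto simp: f_def intro!: continuous_intros\<close>)
  then obtain r where r: "2 \<le> r" "r \<le> 3" "f r = 0" by blast
  define h where "h = 1 / r - (1 - r / 2) ^ 2"
  have "(1 - r / 2) ^ 2 \<le> (1 / 2) ^ 2" using r by (intro power2_le_iff_abs_le[THEN iffD2]) (auto simp: abs_le_iff)
  moreover have "1 / r > 1 / 4" using r by (simp add: field_simps)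
  ultimately have h: "h > 0" unfolding h_def by (simp add: power2_eq_square)
  define z where "z = Complex (1 - r / 2) (sqrt h)"
  have zz: "z * cnj z = of_real (1 / r)"
    unfolding complex_mult_cnj using h by (simp add: z_def h_def)
  have zs: "z + cnj z = of_real (2 - r)" unfolding complex_add_cnj by (simp add: z_def)
  have "r * (2 - r) + 1 / r = - of_int b"
  proof -
    have "r * (r * (2 - r) + 1 / r) = r * (- of_int b)"
      using r(1,3) by (simp add: f_def algebra_simps power2_eq_square power3_eq_cube)
    then show ?thesis using r(1) by (subst (asm) mult_left_cancel) auto
  qed
  then have e2: "complex_of_real (r * (2 - r) + 1 / r) = - of_int b" by simp
  show ?thesis
  proof (rule that[of r z])
    show "of_real r + z + cnj z = 2" using zs by (simp add: add.assoc)
    have "of_real r * z + of_real r * cnj z + z * cnj z = of_real r * (z + cnj z) + z * cnj z"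
      by (simp add: algebra_simps)
    also have "\<dots> = complex_of_real (r * (2 - r) + 1 / r)" unfolding zz zs by simp
    finally show "of_real r * z + of_real r * cnj z + z * cnj z = - of_int b" unfolding e2 .
    show "of_real r * z * cnj z = 1" unfolding mult.assoc zz using r(1) by simp
    show "Im z \<noteq> 0" using h by (simp add: z_def)
  qed
qed

text \<open>The pair (V_n, V_(n+1)) of the companion Lucas sequence. It expresses
  \<open>x ^ n + y ^ n\<close> through \<open>s = x + y\<close> and \<open>q = x * y\<close> alone,
  so that power sums can be carried along a field embedding.\<close>

primrec lucas_v :: "'a::comm_ring_1 \<Rightarrow> 'a \<Rightarrow> nat \<Rightarrow> 'a \<times> 'a" where
  "lucas_v s q 0 = (2, s)"
| "lucas_v s q (Suc n) = (snd (lucas_v s q n), s * snd (lucas_v s q n) - q * fst (lucas_v s q n))"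

lemma lucas_v_eq: "lucas_v (x + y) (x * y) n = (x ^ n + y ^ n, x ^ Suc n + y ^ Suc n)"
  by (induction n) (auto simp: algebra_simps)

text \<open>The imaginary parts of \<open>u\<close> and \<open>v\<close> cancel, so their real parts
  agree up to sign, and opposite signs would force \<open>x = 0\<close>.\<close>

lemma isosceles:
  fixes x u v :: complex
  assumes "Im x = 0" "x \<noteq> 0" "cmod u = cmod v" "x + u + v = 0"
  shows "v = cnj u"
proof -
  have i: "Im v = - Im u" using arg_cong[OF assms(4), of Im] assms(1) by simp
  have "(Re u) ^ 2 = (Re v) ^ 2"
    using arg_cong[OF assms(3), of "\<lambda>t. t ^ 2"] i by (simp add: cmod_power2)
  then have "Re u = Re v \<or> Re u = - Re v" by (simp add: power2_eq_iff)
  moreover have "Re x \<noteq> 0" using assms(1,2) complex_eq_iff by auto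
  then have "Re u \<noteq> - Re v" using arg_cong[OF assms(4), of Re] by auto
  ultimately show ?thesis using i by (simp add: complex_eq_iff)
qed

section \<open>The embedding of the cubic field that sends \<open>l1\<close> to
  \<open>l2\<close>\<close>

locale tripell_complex = tripell_roots +
  fixes r :: real
  assumes l1_real: "l1 = of_real r" and l3_cnj: "l3 = cnj l2" and Im_l2: "Im l2 \<noteq> 0" and b12: "b = 1 \<or> b = 2"
begin

lemma roots_distinct: "l1 \<noteq> l2" "l1 \<noteq> l3" "l2 \<noteq> l3"
  using l1_real l3_cnj Im_l2 by (auto simp: complex_eq_iff)

lemma l1_degree_three:
  fixes c0 c1 c2 :: rat
  assumes eq: "of_rat c0 + of_rat c1 * l1 + of_rat c2 * l1 ^ 2 = 0"
  shows "c0 = 0" "c1 = 0" "c2 = 0"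
proof -
  have lin: "c = 0 \<and> d = 0" if "of_rat c + of_rat d * l1 = 0" for c d :: rat
  proof (cases "d = 0")
    case False
    define t where "t = - c / d"
    have "l1 = of_rat t" using that False by (simp add: t_def of_rat_divide of_rat_minus field_simps add_eq_0_iff)
    then have "of_rat (t ^ 3) = (of_rat (2 * t ^ 2 + of_int b * t + 1) :: complex)"
      using roots_cubic(1) by (simp add: of_rat_power of_rat_add of_rat_mult)
    then have "t ^ 3 = 2 * t ^ 2 + of_int b * t + 1" by (simp only: of_rat_eq_iff)
    then show ?thesis using cubic_no_rational_root[OF b12] by blast
  qed (use that in simp)
  have c2: "c2 = 0"
  proof (rule ccontr)
    assume c2: "c2 \<noteq> 0"
    define u v where "u = - c1 / c2" and "v = - c0 / c2"
    have sq: "l1 ^ 2 = of_rat u * l1 + of_rat v"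
    proof -
      have "of_rat c2 * (of_rat u * l1 + of_rat v) = of_rat (c2 * u) * l1 + of_rat (c2 * v)"
        by (simp add: algebra_simps of_rat_mult)
      also have "\<dots> = - of_rat c1 * l1 - of_rat c0"
        using c2 by (simp add: u_def v_def of_rat_minus)
      also have "\<dots> = of_rat c2 * l1 ^ 2" using eq by algebra
      finally show ?thesis using c2 by simp
    qed
    \<comment> \<open>The remainder of the cubic modulo z^2 - u z - v, evaluated at
      \<open>l1\<close>. By \<open>lin\<close> its coefficients vanish, so the quadratic divides the
      cubic and leaves the rational root \<open>2 - u\<close>.\<close>
    have "(of_rat u * of_rat v - 2 * of_rat v - 1) + (of_rat u * of_rat u + of_rat v - 2 * of_rat u - of_int b) * l1 = 0"
      using sq roots_cubic(1) by algebra
    then have "of_rat (u * v - 2 * v - 1) + of_rat (u * u + v - 2 * u - of_int b) * l1 = 0"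
      by (simp add: of_rat_add of_rat_mult of_rat_diff)
    from lin[OF this] have "u * v - 2 * v - 1 = 0" "u * u + v - 2 * u - of_int b = 0" by auto
    then have "(2 - u) ^ 3 = 2 * (2 - u) ^ 2 + of_int b * (2 - u) + 1" by algebra
    then show False using cubic_no_rational_root[OF b12] by blast
  qed
  then show "c0 = 0" "c1 = 0" "c2 = 0" using lin[of c0 c1] eq by auto
qed

text \<open>The graph of the embedding of Q(l1) with \<open>l1\<close> sent to \<open>l2\<close>,
  kept as a relation on rational coordinates; \<open>conj_pair_zero\<close> is what makes it
  single-valued.\<close>

definition conj_pair :: "complex \<Rightarrow> complex \<Rightarrow> bool" where
  "conj_pair u v \<longleftrightarrow> (\<exists>c0 c1 c2 :: rat. u = of_rat c0 + of_rat c1 * l1 + of_rat c2 * l1 ^ 2 \<and>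
     v = of_rat c0 + of_rat c1 * l2 + of_rat c2 * l2 ^ 2)"

lemma conj_pair_zero: "conj_pair 0 v \<Longrightarrow> v = 0"
proof -
  assume "conj_pair 0 v"
  then obtain c0 c1 c2 :: rat where c: "of_rat c0 + of_rat c1 * l1 + of_rat c2 * l1 ^ 2 = 0"
    "v = of_rat c0 + of_rat c1 * l2 + of_rat c2 * l2 ^ 2" unfolding conj_pair_def by metis
  then show ?thesis using l1_degree_three[OF c(1)] by simp
qed

lemma conj_pair_of_rat: "conj_pair (of_rat c) (of_rat c)"
  unfolding conj_pair_def by (rule exI[of _ c], rule exI[of _ 0], rule exI[of _ 0]) simp

lemma conj_pair_roots: "conj_pair l1 l2"
  unfolding conj_pair_def by (rule exI[of _ 0], rule exI[of _ 1], rule exI[of _ 0]) simp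

lemma conj_pair_add:
  assumes "conj_pair u v" "conj_pair u' v'"
  shows "conj_pair (u + u') (v + v')"
proof -
  from assms obtain c0 c1 c2 d0 d1 d2 where
    "u = of_rat c0 + of_rat c1 * l1 + of_rat c2 * l1 ^ 2" "v = of_rat c0 + of_rat c1 * l2 + of_rat c2 * l2 ^ 2"
    "u' = of_rat d0 + of_rat d1 * l1 + of_rat d2 * l1 ^ 2" "v' = of_rat d0 + of_rat d1 * l2 + of_rat d2 * l2 ^ 2"
    unfolding conj_pair_def by blast
  then show ?thesis unfolding conj_pair_def
    by (intro exI[of _ "c0 + d0"] exI[of _ "c1 + d1"] exI[of _ "c2 + d2"]) (simp add: of_rat_add algebra_simps)
qed

lemma conj_pair_mult_root:
  assumes "conj_pair u v"
  shows "conj_pair (l1 * u) (l2 * v)"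
proof -
  from assms obtain c0 c1 c2 where
    c: "u = of_rat c0 + of_rat c1 * l1 + of_rat c2 * l1 ^ 2" "v = of_rat c0 + of_rat c1 * l2 + of_rat c2 * l2 ^ 2"
    unfolding conj_pair_def by blast
  have "l * (of_rat c0 + of_rat c1 * l + of_rat c2 * l ^ 2) =
      of_rat c2 + of_rat (c0 + of_int b * c2) * l + of_rat (c1 + 2 * c2) * l ^ 2"
    if "l ^ 3 = 2 * l ^ 2 + of_int b * l + 1" for l
  proof -
    have "l * (of_rat c0 + of_rat c1 * l + of_rat c2 * l ^ 2) = of_rat c0 * l + of_rat c1 * l ^ 2 + of_rat c2 * l ^ 3"
      by (simp add: algebra_simps power2_eq_square power3_eq_cube)
    then show ?thesis unfolding that by (simp add: algebra_simps of_rat_add of_rat_mult)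
  qed
  from this[OF roots_cubic(1)] this[OF roots_cubic(2)] show ?thesis unfolding conj_pair_def c
    by (intro exI[of _ c2] exI[of _ "c0 + of_int b * c2"] exI[of _ "c1 + 2 * c2"] conjI)
qed

lemma conj_pair_scale:
  assumes "conj_pair u v"
  shows "conj_pair (of_rat c * u) (of_rat c * v)"
proof -
  from assms obtain c0 c1 c2 where
    c: "u = of_rat c0 + of_rat c1 * l1 + of_rat c2 * l1 ^ 2" "v = of_rat c0 + of_rat c1 * l2 + of_rat c2 * l2 ^ 2"
    unfolding conj_pair_def by blast
  show ?thesis unfolding conj_pair_def c
    by (intro exI[of _ "c * c0"] exI[of _ "c * c1"] exI[of _ "c * c2"] conjI)
      (simp_all only: of_rat_mult distrib_left mult.assoc)
qed

lemma conj_pair_mult: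
  assumes "conj_pair u v" "conj_pair u' v'"
  shows "conj_pair (u * u') (v * v')"
proof -
  from assms(1) obtain c0 c1 c2 where
    c: "u = of_rat c0 + of_rat c1 * l1 + of_rat c2 * l1 ^ 2" "v = of_rat c0 + of_rat c1 * l2 + of_rat c2 * l2 ^ 2"
    unfolding conj_pair_def by blast
  have "conj_pair (of_rat c0 * u' + of_rat c1 * (l1 * u') + of_rat c2 * (l1 * (l1 * u')))
     (of_rat c0 * v' + of_rat c1 * (l2 * v') + of_rat c2 * (l2 * (l2 * v')))"
    by (intro conj_pair_add conj_pair_scale conj_pair_mult_root assms)
  then show ?thesis unfolding c by (simp add: algebra_simps power2_eq_square)
qed

lemma conj_pair_diff: "conj_pair u v \<Longrightarrow> conj_pair u' v' \<Longrightarrow> conj_pair (u - u') (v - v')"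
  using conj_pair_add[of u v "- u'" "- v'"] conj_pair_scale[of u' v' "-1"] by simp

lemma conj_pair_lucas:
  assumes "conj_pair s s'" "conj_pair q q'"
  shows "conj_pair (fst (lucas_v s q n)) (fst (lucas_v s' q' n)) \<and> conj_pair (snd (lucas_v s q n)) (snd (lucas_v s' q' n))"
  using assms conj_pair_of_rat[of 2] by (induction n) (auto intro: conj_pair_mult conj_pair_diff)

lemma conj_pair_power_int: "conj_pair (l1 powi n) (l2 powi n)"
  unfolding conj_pair_def
  by (rule exI[of _ "of_int (X (n - 2))"], rule exI[of _ "of_int (X n - 2 * X (n - 1))"], rule exI[of _ "of_int (X (n - 1))"])
    (simp add: power_int_expand[of l1 n] power_int_expand[of l2 n] of_rat_diff of_rat_mult algebra_simps)

end

section \<open>Twisted relations force zeros\<close>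

context tripell_complex
begin

text \<open>Minus the discriminant of the cubic.\<close>

definition disc :: int where "disc = 59 + 36 * b - 4 * b ^ 2 - 4 * b ^ 3"

definition chi' :: "complex \<Rightarrow> complex" where "chi' l = 3 * l ^ 2 - 4 * l - of_int b"

definition beta :: "int \<Rightarrow> complex \<Rightarrow> complex" where "beta a l = l powi (a + 1) / chi' l"

lemma disc_values: "disc = 87 \<or> disc = 83"
  using b12 by (auto simp: disc_def)

lemma disc_nonzero: "complex_of_int disc \<noteq> 0"
  using disc_values by auto

lemma chi'_roots: "chi' l1 = (l1 - l2) * (l1 - l3)" "chi' l2 = (l2 - l1) * (l2 - l3)" "chi' l3 = (l3 - l1) * (l3 - l2)"
proof -
  have l: "chi' l = 3 * l ^ 2 - 2 * (l1 + l2 + l3) * l + (l1 * l2 + l1 * l3 + l2 * l3)" for l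
    unfolding e1 e2 chi'_def by simp
  show "chi' l1 = (l1 - l2) * (l1 - l3)" "chi' l2 = (l2 - l1) * (l2 - l3)" "chi' l3 = (l3 - l1) * (l3 - l2)"
    unfolding l by (simp_all add: algebra_simps power2_eq_square)
qed

lemma chi'_nonzero: "chi' l1 \<noteq> 0" "chi' l2 \<noteq> 0" "chi' l3 \<noteq> 0"
  using roots_distinct unfolding chi'_roots by auto

lemma chi'_prod: "chi' l1 * chi' l2 * chi' l3 = of_int disc"
proof -
  have "complex_of_int disc = - ((l1 + l2 + l3) ^ 2 * (l1 * l2 + l1 * l3 + l2 * l3) ^ 2
      - 4 * (l1 * l2 + l1 * l3 + l2 * l3) ^ 3 - 4 * (l1 + l2 + l3) ^ 3 * (l1 * l2 * l3)
      + 18 * (l1 + l2 + l3) * (l1 * l2 + l1 * l3 + l2 * l3) * (l1 * l2 * l3) - 27 * (l1 * l2 * l3) ^ 2)"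
    unfolding e1 e2 e3 disc_def by simp
  also have "\<dots> = chi' l1 * chi' l2 * chi' l3" unfolding chi'_roots by algebra
  finally show ?thesis by simp
qed

text \<open>The second factor is the Bezout cofactor of \<open>chi'\<close> modulo the cubic. It
  puts \<open>1 / chi' l\<close> into Q(l) with the same coefficients for every root, which makes
  \<open>beta\<close> compatible with the embedding.\<close>

lemma chi'_inverse:
  assumes "l ^ 3 = 2 * l ^ 2 + of_int b * l + 1"
  shows "chi' l * (of_int (4 * b ^ 2 + 4 * b - 6) + of_int (14 * b + 25) * l - of_int (8 + 6 * b) * l ^ 2) = of_int disc"
  using assms unfolding chi'_def disc_def of_int_add of_int_diff of_int_mult of_int_power of_int_numeral
  by algebra

lemma conj_pair_chi': "conj_pair (chi' l1) (chi' l2)"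
  unfolding chi'_def
  using conj_pair_diff[OF conj_pair_diff[OF conj_pair_scale[OF conj_pair_mult[OF conj_pair_roots conj_pair_roots], of 3]
     conj_pair_scale[OF conj_pair_roots, of 4]] conj_pair_of_rat[of "of_int b"]]
  by (simp add: power2_eq_square)

lemma conj_pair_beta: "conj_pair (beta a l1) (beta a l2)"
proof -
  define g :: "complex \<Rightarrow> complex" where
    "g l = of_int (4 * b ^ 2 + 4 * b - 6) + of_int (14 * b + 25) * l - of_int (8 + 6 * b) * l ^ 2" for l
  have g: "beta a l = of_rat (1 / of_int disc) * (l powi (a + 1) * g l)"
    if "l ^ 3 = 2 * l ^ 2 + of_int b * l + 1" "chi' l \<noteq> 0" for l
    using chi'_inverse[OF that(1)] that(2) disc_nonzero unfolding beta_def g_def[symmetric]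
    by (simp add: of_rat_divide field_simps)
  have "conj_pair (g l1) (g l2)"
    unfolding g_def
    using conj_pair_diff[OF conj_pair_add[OF conj_pair_of_rat[of "of_int (4 * b ^ 2 + 4 * b - 6)"]
       conj_pair_scale[OF conj_pair_roots, of "of_int (14 * b + 25)"]]
       conj_pair_scale[OF conj_pair_mult[OF conj_pair_roots conj_pair_roots], of "of_int (8 + 6 * b)"]]
    unfolding of_rat_of_int_eq by (simp only: power2_eq_square)
  then show ?thesis
    unfolding g[OF roots_cubic(1) chi'_nonzero(1)] g[OF roots_cubic(2) chi'_nonzero(2)]
    by (intro conj_pair_scale conj_pair_mult conj_pair_power_int)
qed

lemma beta_sum: "beta a l1 + beta a l2 + beta a l3 = of_int (X a)"
proof -
  have d: "delta = chi' l1 * (l2 - l3)" "delta = chi' l2 * (l3 - l1)" "delta = chi' l3 * (l1 - l2)"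
    unfolding delta_def chi'_roots by algebra+
  have "delta \<noteq> 0" unfolding d(1) using chi'_nonzero roots_distinct by simp
  have "(beta a l1 + beta a l2 + beta a l3) * delta = beta a l1 * delta + beta a l2 * delta + beta a l3 * delta"
    by (simp add: algebra_simps)
  also have "beta a l1 * delta = l1 powi (a + 1) * (l2 - l3)"
    unfolding d(1) beta_def using chi'_nonzero by simp
  also have "beta a l2 * delta = l2 powi (a + 1) * (l3 - l1)"
    unfolding d(2) beta_def using chi'_nonzero by simp
  also have "beta a l3 * delta = l3 powi (a + 1) * (l1 - l2)"
    unfolding d(3) beta_def using chi'_nonzero by simp
  also note binet
  finally show ?thesis using \<open>delta \<noteq> 0\<close> by simp
qed

lemma beta_twisted:
  assumes "l1 powi (a + 1) * (l2 - l3) + \<xi> * (l2 powi (a + 1) * (l3 - l1)) + \<eta> * (l3 powi (a + 1) * (l1 - l2)) = 0"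
  shows "beta a l1 + \<xi> * beta a l2 + \<eta> * beta a l3 = 0"
proof -
  have d: "delta = chi' l1 * (l2 - l3)" "delta = chi' l2 * (l3 - l1)" "delta = chi' l3 * (l1 - l2)"
    unfolding delta_def chi'_roots by algebra+
  have "delta \<noteq> 0" unfolding d(1) using chi'_nonzero roots_distinct by simp
  have "(beta a l1 + \<xi> * beta a l2 + \<eta> * beta a l3) * delta = beta a l1 * delta + \<xi> * (beta a l2 * delta) + \<eta> * (beta a l3 * delta)"
    by (simp add: algebra_simps)
  also have "beta a l1 * delta = l1 powi (a + 1) * (l2 - l3)"
    unfolding d(1) beta_def using chi'_nonzero by simp
  also have "beta a l2 * delta = l2 powi (a + 1) * (l3 - l1)"
    unfolding d(2) beta_def using chi'_nonzero by simp
  also have "beta a l3 * delta = l3 powi (a + 1) * (l1 - l2)"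
    unfolding d(3) beta_def using chi'_nonzero by simp
  finally show ?thesis using \<open>delta \<noteq> 0\<close> assms by simp
qed

lemma beta_prod: "beta a l1 * beta a l2 * beta a l3 = 1 / of_int disc"
  unfolding beta_def chi'_prod[symmetric]
  by (simp add: power_int_mult_distrib[symmetric] e3)

text \<open>All three \<open>beta\<close> multiply to \<open>1 / disc\<close>, so the product of two
  is a rational multiple of the inverse of the third and lies in the field of one root.\<close>

lemma beta_pair_prod: "beta a l2 * beta a l3 = l1 powi (- (a + 1)) * chi' l1 * of_rat (1 / of_int disc)"
  "beta a l1 * beta a l3 = l2 powi (- (a + 1)) * chi' l2 * of_rat (1 / of_int disc)"
proof -
  have nz: "l powi n \<noteq> 0" if "l \<in> {l1, l2}" for l n using that roots_nonzero by auto
  have inv: "l powi (- (a + 1)) * chi' l * beta a l = 1" if "l \<in> {l1, l2}" for l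
    using that nz[OF that, of "a + 1"] chi'_nonzero by (auto simp: beta_def power_int_minus simp del: minus_add_distrib)
  have "beta a l1 * beta a l2 * beta a l3 = of_rat (1 / of_int disc)"
    unfolding beta_prod by (simp add: of_rat_divide)
  then have "l1 powi (- (a + 1)) * chi' l1 * of_rat (1 / of_int disc) =
      (l1 powi (- (a + 1)) * chi' l1 * beta a l1) * (beta a l2 * beta a l3)"
    "l2 powi (- (a + 1)) * chi' l2 * of_rat (1 / of_int disc) =
      (l2 powi (- (a + 1)) * chi' l2 * beta a l2) * (beta a l1 * beta a l3)"
    by (simp_all only: flip: \<open>beta a l1 * beta a l2 * beta a l3 = of_rat (1 / of_int disc)\<close>) (simp_all only: ac_simps)
  then show "beta a l2 * beta a l3 = l1 powi (- (a + 1)) * chi' l1 * of_rat (1 / of_int disc)"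
    "beta a l1 * beta a l3 = l2 powi (- (a + 1)) * chi' l2 * of_rat (1 / of_int disc)"
    using inv[of l1] inv[of l2] by (simp_all only: insert_iff mult_1 simp_thms)
qed

lemma conj_pair_beta_prod: "conj_pair (beta a l2 * beta a l3) (beta a l1 * beta a l3)"
  unfolding beta_pair_prod
  by (intro conj_pair_mult conj_pair_power_int conj_pair_chi' conj_pair_of_rat)

lemma beta_cnj: "cnj (beta a l1) = beta a l1" "cnj (beta a l2) = beta a l3" "cnj (beta a l3) = beta a l2"
proof -
  have "cnj (l powi n) = cnj l powi n" for l n by (simp add: power_int_def)
  then have "cnj (beta a l) = beta a (cnj l)" for l by (simp add: beta_def chi'_def)
  then show "cnj (beta a l1) = beta a l1" "cnj (beta a l2) = beta a l3" "cnj (beta a l3) = beta a l2"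
    by (simp_all add: l1_real l3_cnj)
qed

lemma beta_nonzero: "beta a l1 \<noteq> 0" "beta a l2 \<noteq> 0" "beta a l3 \<noteq> 0"
  using roots_nonzero chi'_nonzero by (auto simp: beta_def)

text \<open>The Galois conjugate of a relation \<open>\<beta>\<^sub>1 + \<xi> \<beta>\<^sub>2 + \<xi>\<^sup>-\<^sup>1 \<beta>\<^sub>3 = 0\<close>: the condition \<open>\<xi> ^ N = 1\<close> is an equation
  between Lucas sequences in \<open>\<beta>\<^sub>1\<close> and \<open>\<beta>\<^sub>2 \<beta>\<^sub>3\<close>, hence over \<open>\<rat>(l1)\<close>.\<close>

lemma twisted_relation_conjugate:
  assumes N: "N > 0" "\<xi> ^ N = 1" "\<eta> ^ N = 1" and tw: "beta a l1 + \<xi> * beta a l2 + \<eta> * beta a l3 = 0"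
  obtains \<theta> where "cmod \<theta> = 1" "beta a l2 + \<theta> * beta a l3 + cnj \<theta> * beta a l1 = 0"
proof -
  define b1 b2 b3 where "b1 = beta a l1" and "b2 = beta a l2" and "b3 = beta a l3"
  note bd = b1_def b2_def b3_def
  have nz: "b1 \<noteq> 0" "b2 \<noteq> 0" "b3 \<noteq> 0" using beta_nonzero by (auto simp: bd)
  have cn: "cnj b1 = b1" "cnj b2 = b3" "cnj b3 = b2" using beta_cnj by (auto simp: bd)
  have norm1: "cmod z = 1" if "z ^ N = 1" for z
    using power_eq_1_iff[OF that] N(1) by auto
  \<comment> \<open>The relation is a triangle with one real side \<open>b1\<close> and two sides of
    equal length; hence \<open>\<eta>\<close> is the inverse of \<open>\<xi>\<close>.\<close>
  have "\<eta> * b3 = cnj (\<xi> * b2)"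
  proof (rule isosceles[of b1])
    show "Im b1 = 0" using cn(1) by (simp add: complex_eq_iff)
    have "cmod b3 = cmod b2" using complex_mod_cnj[of b2] cn(2) by simp
    then show "cmod (\<xi> * b2) = cmod (\<eta> * b3)" using norm1 N by (simp add: norm_mult)
  qed (use nz tw in \<open>simp_all add: bd\<close>)
  then have "\<eta> = cnj \<xi>" using nz cn by simp
  moreover have "\<xi> * cnj \<xi> = 1" using norm1[OF N(2)] by (simp add: complex_norm_square[symmetric])
  ultimately have xe: "\<xi> * \<eta> = 1" by simp
  define S :: complex where "S = of_int (X a)"
  have S: "b1 + b2 + b3 = S" using beta_sum by (simp add: bd S_def)
  have "lucas_v (- b1) (b2 * b3) N = lucas_v (\<xi> * b2 + \<eta> * b3) ((\<xi> * b2) * (\<eta> * b3)) N"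
  proof -
    have "\<xi> * b2 + \<eta> * b3 = - b1" using tw unfolding bd by algebra
    moreover have "(\<xi> * b2) * (\<eta> * b3) = b2 * b3" using xe by algebra
    ultimately show ?thesis by (simp only:)
  qed
  then have "fst (lucas_v (- b1) (b2 * b3) N) = (\<xi> * b2) ^ N + (\<eta> * b3) ^ N" by (simp add: lucas_v_eq)
  also have "\<dots> = b2 ^ N + b3 ^ N" using N by (simp add: power_mult_distrib)
  also have "\<dots> = fst (lucas_v (b2 + b3) (b2 * b3) N)" by (simp add: lucas_v_eq)
  also have "b2 + b3 = S - b1" by (simp add: S[symmetric])
  finally have z: "fst (lucas_v (- b1) (b2 * b3) N) - fst (lucas_v (S - b1) (b2 * b3) N) = 0" by simp
  have c1: "conj_pair b1 b2" "conj_pair (b2 * b3) (b1 * b3)" "conj_pair S S"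
    using conj_pair_beta conj_pair_beta_prod conj_pair_of_rat[of "of_int (X a)"] by (auto simp: bd S_def)
  have c2: "conj_pair (- b1) (- b2)" using conj_pair_scale[OF c1(1), of "-1"] by simp
  have "conj_pair (fst (lucas_v (- b1) (b2 * b3) N) - fst (lucas_v (S - b1) (b2 * b3) N))
     (fst (lucas_v (- b2) (b1 * b3) N) - fst (lucas_v (S - b2) (b1 * b3) N))"
    by (intro conj_pair_diff[OF conj_pair_lucas[THEN conjunct1] conj_pair_lucas[THEN conjunct1]] conj_pair_diff c1 c2)
  then have "fst (lucas_v (- b2) (b1 * b3) N) = fst (lucas_v (S - b2) (b1 * b3) N)"
    using conj_pair_zero unfolding z by (metis eq_iff_diff_eq_0)
  also have "S - b2 = b1 + b3" by (simp add: S[symmetric])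
  also have "fst (lucas_v (b1 + b3) (b1 * b3) N) = b1 ^ N + b3 ^ N" by (simp add: lucas_v_eq)
  finally have pow: "fst (lucas_v (- b2) (b1 * b3) N) = b1 ^ N + b3 ^ N" .
  \<comment> \<open>\<open>u\<close> and \<open>v\<close> are the roots of z^2 + b2 z + b1 b3. Their
    \<open>N\<close>-th powers have the same sum and product as \<open>b1 ^ N\<close> and
    \<open>b3 ^ N\<close>, so they are these numbers in some order; the root with power
    \<open>b3 ^ N\<close> yields \<open>\<theta>\<close>.\<close>
  define D where "D = csqrt (b2 ^ 2 - 4 * (b1 * b3))"
  define u v where "u = (- b2 + D) / 2" and "v = (- b2 - D) / 2"
  have uv: "u + v = - b2" "u * v = b1 * b3"
  proof -
    show "u + v = - b2" by (simp add: u_def v_def field_simps)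
    have "D ^ 2 = b2 ^ 2 - 4 * (b1 * b3)" unfolding D_def by simp
    then show "u * v = b1 * b3" by (simp add: u_def v_def field_simps power2_eq_square)
  qed
  have s: "u ^ N + v ^ N = b1 ^ N + b3 ^ N" using pow lucas_v_eq[of u v N] uv by simp
  have q: "u ^ N * v ^ N = b1 ^ N * b3 ^ N" using uv(2) by (simp add: power_mult_distrib[symmetric])
  have "(U - B) * (U - C) = 0" if "U + V = B + C" "U * V = B * C" for U V B C :: complex
    using that by algebra
  from this[OF s q] have "(u ^ N - b1 ^ N) * (u ^ N - b3 ^ N) = 0" .
  then have "u ^ N = b3 ^ N \<or> v ^ N = b3 ^ N" using s by auto
  then obtain x y where xy: "x + y = - b2" "x * y = b1 * b3" "x ^ N = b3 ^ N"
    using uv by (metis add.commute mult.commute)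
  define \<theta> where "\<theta> = x / b3"
  have "\<theta> ^ N = 1" using xy(3) nz by (simp add: \<theta>_def power_divide)
  then have t1: "cmod \<theta> = 1" by (rule norm1)
  then have tt: "\<theta> * cnj \<theta> = 1" by (simp add: complex_norm_square[symmetric])
  have x: "x = \<theta> * b3" using nz by (simp add: \<theta>_def)
  have ty: "\<theta> * y = b1" using xy(2) nz unfolding x by (simp add: ac_simps)
  have "cnj \<theta> * (\<theta> * y) = (\<theta> * cnj \<theta>) * y" by (simp only: ac_simps)
  then have "y = cnj \<theta> * b1" unfolding tt ty by simp
  then have "b2 + \<theta> * b3 + cnj \<theta> * b1 = 0" using xy(1) unfolding x by (simp add: add_eq_0_iff add.assoc)
  with t1 show ?thesis using that unfolding bd by blast
qed

text \<open>Completing the square shows that a zero makes \<open>3 * disc * c2 ^ 2\<close> a square.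
  Here \<open>3 * disc\<close> is 261 = 9 * 29 or 249 = 3 * 83, and 29 or 83 divides it exactly
  once.\<close>

lemma rational_form_anisotropic:
  fixes c1 c2 :: rat
  assumes "of_int (4 + 3 * b) * c1 ^ 2 + of_int (25 + 14 * b) * c1 * c2 + of_int (b ^ 2 + 16 * b + 28) * c2 ^ 2 = 0"
  shows "c1 = 0 \<and> c2 = 0"
proof -
  have "\<exists>q d :: int. prime q \<and> multiplicity q d = 1 \<and>
      (of_int (2 * (4 + 3 * b)) * c1 + of_int (25 + 14 * b) * c2) ^ 2 = of_int d * c2 ^ 2"
    using b12
  proof
    assume b: "b = 1"
    have "multiplicity 29 (261::int) = 1" by (rule multiplicity_eqI) simp_all
    moreover have "prime (29::int)" by simp
    moreover have "(of_int (2 * (4 + 3 * b)) * c1 + of_int (25 + 14 * b) * c2) ^ 2 = of_int 261 * c2 ^ 2"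
      using assms unfolding b by (simp add: power2_eq_square) algebra
    ultimately show ?thesis by blast
  next
    assume b: "b = 2"
    have "multiplicity 83 (249::int) = 1" by (rule multiplicity_eqI) simp_all
    moreover have "prime (83::int)" by simp
    moreover have "(of_int (2 * (4 + 3 * b)) * c1 + of_int (25 + 14 * b) * c2) ^ 2 = of_int 249 * c2 ^ 2"
      using assms unfolding b by (simp add: power2_eq_square) algebra
    ultimately show ?thesis by blast
  qed
  then have "c2 = 0" using rat_square_eq_times_square_imp_zero by blast
  then show ?thesis using assms b12 by auto
qed

text \<open>The left side factors as \<open>f l1 + \<omega> * f l2 + \<omega> ^ 2 * f l3\<close>
  times the same with \<omega> inverted, for a primitive cube root of unity \<omega>. Hence
  \<open>c0\<close> drops out, and the coefficients are symmetric in the roots.\<close>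

lemma norm_form:
  fixes c0 c1 c2 :: complex
  defines "f \<equiv> \<lambda>l. c0 + c1 * l + c2 * l ^ 2"
  shows "f l1 ^ 2 + f l2 ^ 2 + f l3 ^ 2 - f l1 * f l2 - f l1 * f l3 - f l2 * f l3 =
    of_int (4 + 3 * b) * c1 ^ 2 + of_int (25 + 14 * b) * c1 * c2 + of_int (b ^ 2 + 16 * b + 28) * c2 ^ 2"
proof -
  have c1: "of_int (4 + 3 * b) = (l1 + l2 + l3) ^ 2 - 3 * (l1 * l2 + l1 * l3 + l2 * l3)"
    unfolding e1 e2 by simp
  have c2: "of_int (25 + 14 * b) = 2 * (l1 + l2 + l3) ^ 3 - 7 * (l1 + l2 + l3) * (l1 * l2 + l1 * l3 + l2 * l3) + 9 * (l1 * l2 * l3)"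
    unfolding e1 e2 e3 by simp
  have "B ^ 2 + 16 * B + 28 = (2 ^ 2 - 2 * (- B)) ^ 2 - 3 * ((- B) ^ 2 - 2 * 2 * 1)" for B :: complex
    by algebra
  then have c3: "of_int (b ^ 2 + 16 * b + 28) = ((l1 + l2 + l3) ^ 2 - 2 * (l1 * l2 + l1 * l3 + l2 * l3)) ^ 2
      - 3 * ((l1 * l2 + l1 * l3 + l2 * l3) ^ 2 - 2 * (l1 + l2 + l3) * (l1 * l2 * l3))"
    unfolding e1 e2 e3 by simp
  show ?thesis unfolding f_def c1 c2 c3 by algebra
qed

text \<open>The relation makes the form of \<open>norm_form\<close> vanish at rational
  \<open>c1\<close>, \<open>c2\<close>; both are 0, and all three \<open>beta\<close> equal the
  rational \<open>c0\<close>. Then \<open>X a\<close> is three times \<open>c0\<close> and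
  \<open>c0 ^ 3 * disc = 1\<close>, so 87 or 83 would divide 27.\<close>

lemma not_primitive_cube_root:
  assumes t: "\<theta> ^ 2 + \<theta> + 1 = 0" and rel: "beta a l2 + \<theta> * beta a l3 + \<theta> ^ 2 * beta a l1 = 0"
  shows False
proof -
  obtain c0 c1 c2 :: rat where c: "beta a l1 = of_rat c0 + of_rat c1 * l1 + of_rat c2 * l1 ^ 2"
    "beta a l2 = of_rat c0 + of_rat c1 * l2 + of_rat c2 * l2 ^ 2"
    using conj_pair_beta unfolding conj_pair_def by blast
  have cnj_rat: "cnj (of_rat q) = of_rat q" for q
    by (cases q) (simp add: of_rat_rat)
  have "beta a l3 = cnj (beta a l2)" using beta_cnj by simp
  then have c3: "beta a l3 = of_rat c0 + of_rat c1 * l3 + of_rat c2 * l3 ^ 2"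
    unfolding c(2) by (simp add: l3_cnj cnj_rat)
  have "beta a l1 ^ 2 + beta a l2 ^ 2 + beta a l3 ^ 2 - beta a l1 * beta a l2 - beta a l1 * beta a l3 - beta a l2 * beta a l3 = 0"
    using t rel by algebra
  then have "of_int (4 + 3 * b) * of_rat c1 ^ 2 + of_int (25 + 14 * b) * of_rat c1 * of_rat c2
      + of_int (b ^ 2 + 16 * b + 28) * of_rat c2 ^ 2 = (0 :: complex)"
    unfolding c c3 norm_form .
  then have "of_rat (of_int (4 + 3 * b) * c1 ^ 2 + of_int (25 + 14 * b) * c1 * c2 + of_int (b ^ 2 + 16 * b + 28) * c2 ^ 2) = (of_rat 0 :: complex)"
    unfolding of_rat_add of_rat_mult of_rat_power of_rat_of_int_eq of_rat_0 .
  then have "of_int (4 + 3 * b) * c1 ^ 2 + of_int (25 + 14 * b) * c1 * c2 + of_int (b ^ 2 + 16 * b + 28) * c2 ^ 2 = 0"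
    unfolding of_rat_eq_iff .
  from rational_form_anisotropic[OF this] have eq: "beta a l1 = of_rat c0" "beta a l2 = of_rat c0" "beta a l3 = of_rat c0"
    using c c3 by auto
  have "of_int (X a) = 3 * (of_rat c0 :: complex)" using beta_sum[of a] unfolding eq by simp
  moreover have "of_rat c0 * of_rat c0 * of_rat c0 * of_int disc = (1 :: complex)"
    using beta_prod[of a] disc_nonzero unfolding eq by simp
  ultimately have "of_int (X a) ^ 3 * of_int disc = (27 :: complex)" by algebra
  then have "of_int (X a ^ 3 * disc) = (of_int 27 :: complex)" by simp
  then have "X a ^ 3 * disc = 27" unfolding of_int_eq_iff .
  then have "disc dvd 27" by (metis dvd_triv_right)
  then show False using disc_values by auto
qed

text \<open>The Galois conjugate relation and its complex conjugate together give
  \<open>\<theta> ^ 3 = 1\<close>. For \<open>\<theta> = 1\<close> the relation is the Binet sum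
  \<open>X a\<close>; the primitive cube roots are excluded.\<close>

theorem twisted_relation_imp_zero:
  assumes N: "N > 0" "\<xi> ^ N = 1" "\<eta> ^ N = 1" and tw: "beta a l1 + \<xi> * beta a l2 + \<eta> * beta a l3 = 0"
  shows "X a = 0"
proof -
  obtain \<theta> where t: "cmod \<theta> = 1" "beta a l2 + \<theta> * beta a l3 + cnj \<theta> * beta a l1 = 0"
    using twisted_relation_conjugate[OF assms] by blast
  have tt: "\<theta> * cnj \<theta> = 1" using t(1) by (simp add: complex_norm_square[symmetric])
  have conj: "beta a l3 + cnj \<theta> * beta a l2 + \<theta> * beta a l1 = 0"
    using arg_cong[OF t(2), of cnj] by (simp add: beta_cnj)
  have "(\<theta> ^ 3 - 1) * (beta a l2 + \<theta> * beta a l3) = 0" using t(2) conj tt by algebra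
  moreover have "beta a l2 + \<theta> * beta a l3 \<noteq> 0"
    using t beta_nonzero(1)[of a] by auto
  ultimately have "\<theta> ^ 3 = 1" by simp
  then have "(\<theta> - 1) * (\<theta> ^ 2 + \<theta> + 1) = 0" by algebra
  then have "\<theta> = 1 \<or> \<theta> ^ 2 + \<theta> + 1 = 0" by simp
  then show ?thesis
  proof
    assume "\<theta> = 1"
    then have "of_int (X a) = (0::complex)" using t(2) beta_sum[of a] by (simp add: ac_simps)
    then show ?thesis by simp
  next
    assume c: "\<theta> ^ 2 + \<theta> + 1 = 0"
    have "cnj \<theta> = \<theta> ^ 2" using tt \<open>\<theta> ^ 3 = 1\<close> by algebra
    then show ?thesis using not_primitive_cube_root[OF c, of a] t(2) by simp
  qed
qed

end

section \<open>Computation with residues\<close>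

text \<open>\<open>r\<close> lifts to a p-adic zero congruent to \<open>r\<close> modulo
  \<open>p\<close>. Under the conjecture that zero is an integer \<open>a\<close> with
  \<open>X a = 0\<close>, so \<open>r\<close> would be congruent to 0 or -1.\<close>

lemma (in tripell_seq) marques_lengyel_fails:
  assumes b: "b = 1 \<or> b = 2" and zeros: "\<And>n. X n = 0 \<Longrightarrow> n = 0 \<or> n = -1" and per: "tripell_period b X p N"
    and r: "int p ^ 2 dvd X r" "\<not> int p ^ 2 dvd X (r + N) - X r" "\<not> int p dvd r" "\<not> int p dvd r + 1"
  shows "\<not> marques_lengyel (\<lambda>n. of_int (X n)) p"
proof
  interpret P: tripell_period b X p N by fact
  assume ml: "marques_lengyel (\<lambda>n. of_int (X n)) p"
  obtain a where a: "[a = r] (mod int p)" "\<And>m. \<exists>n. int p ^ m dvd n - a \<and> int p ^ m dvd X n"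
    using marques_lengyel_imp_integer_limit[OF P.p(1) ml P.infinitely_many_divisible[OF r(1,2)]] by blast
  obtain \<rho> :: real and z :: complex where z: "of_real \<rho> + z + cnj z = 2"
    "of_real \<rho> * z + of_real \<rho> * cnj z + z * cnj z = - of_int b" "of_real \<rho> * z * cnj z = 1"
    "Im z \<noteq> 0" using cubic_roots_exist[OF b] by blast
  interpret C: tripell_complex b X "of_real \<rho>" z "cnj z" \<rho>
    using z b by unfold_locales auto
  obtain \<xi> \<eta> where "\<xi> ^ N = 1" "\<eta> ^ N = 1" "of_real \<rho> powi (a + 1) * (z - cnj z) + \<xi> * (z powi (a + 1) * (cnj z - of_real \<rho>))
    + \<eta> * (cnj z powi (a + 1) * (of_real \<rho> - z)) = 0"
    using C.twisted_vanishing[OF per a(2)] by metis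
  then have "X a = 0"
    using C.twisted_relation_imp_zero[OF P.N_pos _ _ C.beta_twisted] by blast
  then have "a = 0 \<or> a = -1" by (rule zeros)
  then show False
  proof
    assume "a = 0"
    then show False using a(1) r(3) by (simp add: cong_iff_dvd_diff)
  next
    assume "a = -1"
    then have "int p dvd - (- 1 - r)" using a(1) unfolding dvd_minus_iff by (simp add: cong_iff_dvd_diff)
    then show False using r(4) by (simp add: add.commute)
  qed
qed

text \<open>Residue triples \<open>(x, y, z)\<close> stand for \<open>(X (n - 2), X (n - 1), X n)\<close> modulo \<open>m\<close>; the index is doubled
  by means of the addition formula.\<close>

fun tripell_step :: "int \<Rightarrow> int \<Rightarrow> int \<times> int \<times> int \<Rightarrow> int \<times> int \<times> int" where
  "tripell_step b m (x, y, z) = (y, z, (2 * z + b * y + x) mod m)"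

text \<open>The addition formula for the indices \<open>2 * n - 2\<close>, \<open>2 * n - 1\<close>,
  \<open>2 * n\<close>, with \<open>u\<close>, \<open>v\<close>, \<open>w\<close> standing for
  \<open>X (n + 1)\<close>, \<open>X (n + 2)\<close>, \<open>X n - 2 * X (n - 1)\<close>.\<close>

definition tripell_comb :: "int \<Rightarrow> int \<Rightarrow> int \<Rightarrow> int \<Rightarrow> int \<Rightarrow> int \<Rightarrow> int \<Rightarrow> int \<times> int \<times> int" where
  "tripell_comb m x y z u v w =
     ((y * z + w * y + x * x) mod m, (y * u + w * z + x * y) mod m, (y * v + w * u + x * z) mod m)"

fun tripell_double :: "int \<Rightarrow> int \<Rightarrow> int \<times> int \<times> int \<Rightarrow> int \<times> int \<times> int" where
  "tripell_double b m (x, y, z) =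
     tripell_comb m x y z (2 * z + b * y + x) (2 * (2 * z + b * y + x) + b * z + y) (z - 2 * y)"

fun tripell_pow :: "int \<Rightarrow> int \<Rightarrow> int \<Rightarrow> int \<times> int \<times> int" where
  "tripell_pow b m n = (if n \<le> 1 then (0, 0, 1)
     else if even n then tripell_double b m (tripell_pow b m (n div 2))
     else tripell_step b m (tripell_double b m (tripell_pow b m (n div 2))))"

declare tripell_pow.simps [simp del]

text \<open>Unfolds along the binary digits of the index, down to the triple at index 1.\<close>

lemma tripell_pow_numeral:
  "tripell_pow b m 1 = (0, 0, 1)"
  "tripell_pow b m (numeral num.One) = (0, 0, 1)"
  "tripell_pow b m (numeral (num.Bit0 k)) = tripell_double b m (tripell_pow b m (numeral k))"
  "tripell_pow b m (numeral (num.Bit1 k)) = tripell_step b m (tripell_double b m (tripell_pow b m (numeral k)))"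
  by (subst tripell_pow.simps, simp)+

context tripell_seq
begin

definition residues_at :: "int \<Rightarrow> int \<Rightarrow> int \<times> int \<times> int \<Rightarrow> bool" where
  "residues_at m n = (\<lambda>(x, y, z). [X (n - 2) = x] (mod m) \<and> [X (n - 1) = y] (mod m) \<and> [X n = z] (mod m))"

lemma residues_at_step: "residues_at m n s \<Longrightarrow> residues_at m (n + 1) (tripell_step b m s)"
proof (cases s)
  case (fields x y z)
  assume "residues_at m n s"
  then have r: "[X (n - 2) = x] (mod m)" "[X (n - 1) = y] (mod m)" "[X n = z] (mod m)"
    by (auto simp: residues_at_def fields)
  have "X (n + 1) = 2 * X n + b * X (n - 1) + X (n - 2)" using recursD[OF rec, of "n - 2"] by (simp add: add.commute)
  then have "[X (n + 1) = 2 * z + b * y + x] (mod m)" using r by (auto intro!: cong_add cong_mult)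
  then show ?thesis using r by (simp add: residues_at_def fields)
qed

lemma residues_at_double: "residues_at m n s \<Longrightarrow> residues_at m (2 * n) (tripell_double b m s)"
proof (cases s)
  case (fields x y z)
  assume "residues_at m n s"
  then have r: "[X (n - 2) = x] (mod m)" "[X (n - 1) = y] (mod m)" "[X n = z] (mod m)"
    by (auto simp: residues_at_def fields)
  define u v w where "u = 2 * z + b * y + x" and "v = 2 * u + b * z + y" and "w = z - 2 * y"
  have "X (n + 1) = 2 * X n + b * X (n - 1) + X (n - 2)" using recursD[OF rec, of "n - 2"] by (simp add: add.commute)
  then have u: "[X (n + 1) = u] (mod m)" unfolding u_def using r by (auto intro!: cong_add cong_mult)
  have "X (n + 2) = 2 * X (n + 1) + b * X n + X (n - 1)" using recursD[OF rec, of "n - 1"] by (simp add: add.commute)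
  then have v: "[X (n + 2) = v] (mod m)" unfolding v_def using r u by (auto intro!: cong_add cong_mult)
  have w: "[X n - 2 * X (n - 1) = w] (mod m)" unfolding w_def using r by (auto intro!: cong_diff cong_mult)
  have add: "X (k + n) = X (n - 1) * X (k + 2) + (X n - 2 * X (n - 1)) * X (k + 1) + X (n - 2) * X k" for k
    using recurs_addition[OF rec, of k n] by simp
  have e: "n - 2 + n = 2 * n - 2" "n - 2 + 2 = n" "n - 2 + 1 = n - 1" "n - 1 + n = 2 * n - 1"
    "n - 1 + 2 = n + 1" "n - 1 + 1 = n" "n + n = 2 * n" by simp_all
  note a = add[of "n - 2", unfolded e] add[of "n - 1", unfolded e] add[of n, unfolded e]
  have "[X (2 * n - 2) = y * z + w * y + x * x] (mod m)" "[X (2 * n - 1) = y * u + w * z + x * y] (mod m)"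
    "[X (2 * n) = y * v + w * u + x * z] (mod m)"
    unfolding a by (intro cong_add cong_mult r u v w)+
  then show ?thesis by (simp add: residues_at_def fields tripell_comb_def u_def v_def w_def)
qed

lemma residues_at_pow: "n \<ge> 1 \<Longrightarrow> residues_at m n (tripell_pow b m n)"
proof (induction "nat n" arbitrary: n rule: less_induct)
  case less
  show ?case
  proof (cases "n = 1")
    case True
    then show ?thesis by (simp add: tripell_pow.simps residues_at_def X0 X1 X_neg)
  next
    case False
    with less.prems have "n div 2 \<ge> 1" "nat (n div 2) < nat n" by linarith+
    from residues_at_double[OF less.hyps[OF this(2,1)]]
    have d: "residues_at m (2 * (n div 2)) (tripell_double b m (tripell_pow b m (n div 2)))" .
    show ?thesis
    proof (cases "even n")
      case True
      then show ?thesis using d False less.prems by (subst tripell_pow.simps) auto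
    next
      case odd: False
      then have "2 * (n div 2) + 1 = n" by presburger
      with residues_at_step[OF d] show ?thesis using odd False less.prems by (subst tripell_pow.simps) auto
    qed
  qed
qed
end

section \<open>Certificates and their soundness\<close>

fun tripell_nonzero_run :: "int \<Rightarrow> int \<Rightarrow> nat \<Rightarrow> int \<times> int \<times> int \<Rightarrow> bool" where
  "tripell_nonzero_run b m 0 s = True"
| "tripell_nonzero_run b m (Suc k) s = (snd (snd s) mod m \<noteq> 0 \<and> tripell_nonzero_run b m k (tripell_step b m s))"

lemma (in tripell_seq) nonzero_run:
  assumes "tripell_nonzero_run b m k s" "residues_at m n s" "n \<le> i" "i < n + int k"
  shows "\<not> m dvd X i"
  using assms
proof (induction k arbitrary: n s)
  case (Suc k)
  show ?case
  proof (cases "i = n")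
    case True
    have "[X n = snd (snd s)] (mod m)" using Suc.prems(2) by (auto simp: residues_at_def)
    from cong_dvd_iff[OF this] show ?thesis using Suc.prems(1) True by (simp add: dvd_eq_mod_eq_0)
  next
    case False
    show ?thesis
      by (rule Suc.IH[OF _ residues_at_step[OF Suc.prems(2)]]) (use False Suc.prems in simp_all)
  qed
qed simp

text \<open>\<open>X (r + N) - X r\<close> by the addition formula, from the triples at
  \<open>N\<close> and at \<open>r\<close>.\<close>

fun tripell_increment :: "int \<Rightarrow> int \<times> int \<times> int \<Rightarrow> int \<times> int \<times> int \<Rightarrow> int" where
  "tripell_increment b (x, y, z) (x', y', z') =
     y * (2 * (2 * z' + b * y' + x') + b * z' + y') + (z - 2 * y) * (2 * z' + b * y' + x') + x * z' - z'"

text \<open>By Newton's congruence with \<open>s = 0\<close>, \<open>X (r + N * l)\<close> is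
  \<open>X r + l * d\<close> modulo \<open>p ^ 2\<close>: this tests the zero,
  \<open>d \<noteq> 0\<close> its simplicity, and the last two conditions keep it away from 0 and -1
  modulo \<open>p\<close>.\<close>

definition nontrivial_zero_cert :: "int \<Rightarrow> int \<times> int \<times> int \<times> int \<Rightarrow> bool" where
  "nontrivial_zero_cert b = (\<lambda>(p, N, r, l). N \<ge> 1 \<and> r \<ge> 1 \<and>
     (let s = tripell_pow b (p * p) N; t = tripell_pow b (p * p) r; d = tripell_increment b s t mod (p * p) in
       fst s mod p = 1 \<and> fst (snd s) mod p = 0 \<and> snd (snd s) mod p = 0 \<and> d \<noteq> 0 \<and>
       (snd (snd t) + l * d) mod (p * p) = 0 \<and> (r + N * l) mod p \<noteq> 0 \<and> (r + N * l + 1) mod p \<noteq> 0))"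

text \<open>The run starts at index 1 and visits \<open>k = N - 2\<close> indices, that is every
  class except those of 0 and -1.\<close>

definition trivial_zeros_cert :: "int \<Rightarrow> int \<times> int \<times> nat \<Rightarrow> bool" where
  "trivial_zeros_cert b = (\<lambda>(p, N, k). N \<ge> 1 \<and> int k = N - 2 \<and> tripell_nonzero_run b p k (0, 0, 1) \<and>
     (let s = tripell_pow b (p * p) N in
       fst s mod p = 1 \<and> fst (snd s) mod p = 0 \<and> snd (snd s) mod p = 0 \<and>
       fst (snd s) mod (p * p) \<noteq> 0 \<and> snd (snd s) mod (p * p) \<noteq> 0 \<and> N mod p \<noteq> 0))"

lemma (in tripell_seq) tripell_period_cert:
  assumes p: "prime p" "p \<ge> 3" and N: "N \<ge> 1"
    and s: "s = tripell_pow b (int p * int p) N"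
      "fst s mod int p = 1" "fst (snd s) mod int p = 0" "snd (snd s) mod int p = 0"
  shows "tripell_period b X p (nat N)"
proof -
  have r: "residues_at (int p * int p) N s" unfolding s(1) by (rule residues_at_pow[OF N])
  have m: "[u = v] (mod int p)" if "[u = v] (mod (int p * int p))" for u v
    using that by (rule cong_dvd_modulus) simp
  have "[X (N - 2) = fst s] (mod int p)" "[X (N - 1) = fst (snd s)] (mod int p)" "[X N = snd (snd s)] (mod int p)"
    using r by (auto simp: residues_at_def intro!: m)
  moreover have "[fst s = 1] (mod int p)" "[fst (snd s) = 0] (mod int p)" "[snd (snd s) = 0] (mod int p)"
    using s(2-4) dvd_minus_mod[of "int p" "fst s"] by (auto simp: cong_iff_dvd_diff)
  ultimately have "[X (N - 2) = 1] (mod int p)" "[X (N - 1) = 0] (mod int p)" "[X N = 0] (mod int p)"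
    using cong_trans by blast+
  then show ?thesis using p N by unfold_locales (auto simp: rec X0 X1 X2)
qed

lemma (in tripell_seq) nontrivial_zero_cert_sound:
  assumes b: "b = 1 \<or> b = 2" and zeros: "\<And>n. X n = 0 \<Longrightarrow> n = 0 \<or> n = -1"
    and p: "prime p" "p \<ge> 3" and cert: "nontrivial_zero_cert b (int p, N, r, l)"
  shows "\<not> marques_lengyel (\<lambda>n. of_int (X n)) p"
proof -
  define s t d where "s = tripell_pow b (int p * int p) N" and "t = tripell_pow b (int p * int p) r"
    and "d = tripell_increment b s t"
  have N: "N \<ge> 1" "r \<ge> 1" and s: "fst s mod int p = 1" "fst (snd s) mod int p = 0" "snd (snd s) mod int p = 0"
    and d: "d mod (int p * int p) \<noteq> 0" and l: "(snd (snd t) + l * (d mod (int p * int p))) mod (int p * int p) = 0"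
    and nd: "(r + N * l) mod int p \<noteq> 0" "(r + N * l + 1) mod int p \<noteq> 0"
    using cert unfolding nontrivial_zero_cert_def s_def t_def d_def by (auto simp: Let_def)
  have per: "tripell_period b X p (nat N)" by (rule tripell_period_cert[OF p N(1) s_def s])
  interpret P: tripell_period b X p "nat N" by fact
  have NN: "int (nat N) = N" using N by simp
  let ?m = "int p * int p"
  have pp: "int p ^ 2 = ?m" by (simp add: power2_eq_square)
  obtain x y z x' y' z' where st: "s = (x, y, z)" "t = (x', y', z')" by (cases s, cases t)
  have rs: "[X (N - 2) = x] (mod ?m)" "[X (N - 1) = y] (mod ?m)" "[X N = z] (mod ?m)"
    using residues_at_pow[OF N(1), of ?m] unfolding s_def[symmetric] st by (auto simp: residues_at_def)
  have rt: "[X (r - 2) = x'] (mod ?m)" "[X (r - 1) = y'] (mod ?m)" "[X r = z'] (mod ?m)"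
    using residues_at_pow[OF N(2), of ?m] unfolding t_def[symmetric] st by (auto simp: residues_at_def)
  have "X (r + 1) = 2 * X r + b * X (r - 1) + X (r - 2)" using recursD[OF rec, of "r - 2"] by (simp add: add.commute)
  then have r1: "[X (r + 1) = 2 * z' + b * y' + x'] (mod ?m)" using rt by (auto intro!: cong_add cong_mult)
  have "X (r + 2) = 2 * X (r + 1) + b * X r + X (r - 1)" using recursD[OF rec, of "r - 1"] by (simp add: add.commute)
  then have r2: "[X (r + 2) = 2 * (2 * z' + b * y' + x') + b * z' + y'] (mod ?m)"
    by (simp only:) (intro cong_add cong_mult cong_refl rt r1)
  have "X (r + N) - X r = X (N - 1) * X (r + 2) + (X N - 2 * X (N - 1)) * X (r + 1) + X (N - 2) * X r - X r"
    using recurs_addition[OF rec, of r N] by simp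
  then have inc: "[X (r + N) - X r = d] (mod ?m)"
    unfolding d_def st tripell_increment.simps
    by (simp only:) (intro cong_add cong_mult cong_diff cong_refl rs rt r1 r2)
  have "[X (r + N * l) = X r + l * (X (r + N) - X r)] (mod ?m)"
    using P.newton_mod[OF rec, of 0 l r, unfolded NN] by (simp add: pp)
  also have "[X r + l * (X (r + N) - X r) = z' + l * d] (mod ?m)"
    using rt inc by (intro cong_add cong_mult) auto
  also have "[z' + l * d = z' + l * (d mod ?m)] (mod ?m)"
    by (intro cong_add cong_mult cong_refl) (simp add: cong_iff_dvd_diff)
  also have "[z' + l * (d mod ?m) = 0] (mod ?m)" using l by (simp add: st cong_0_iff mod_eq_0_iff_dvd)
  finally have z: "int p ^ 2 dvd X (r + N * l)" by (simp add: cong_0_iff pp)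
  have inc': "[X (r + N * l + N) - X (r + N * l) = X (r + N) - X r] (mod ?m)"
    using P.diff_mod_p2[OF rec, of r l, unfolded NN] by (simp only: pp)
  then have nz: "\<not> int p ^ 2 dvd X (r + N * l + N) - X (r + N * l)"
    unfolding pp using d cong_dvd_iff[OF cong_trans[OF inc' inc]] by (simp add: dvd_eq_mod_eq_0)
  show ?thesis
    by (rule marques_lengyel_fails[OF b zeros per z]) (use nz nd in \<open>simp_all only: NN dvd_eq_mod_eq_0 not_False_eq_True\<close>)
qed

lemma (in tripell_seq) trivial_zeros_cert_sound:
  assumes p: "prime p" "p \<ge> 3" and cert: "trivial_zeros_cert b (int p, N, k)"
  shows "tripell_trivial_zeros b X p (nat N)"
proof -
  define s where "s = tripell_pow b (int p * int p) N"
  have N: "N \<ge> 1" "int k = N - 2" and run: "tripell_nonzero_run b (int p) k (0, 0, 1)"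
    and s: "fst s mod int p = 1" "fst (snd s) mod int p = 0" "snd (snd s) mod int p = 0"
    and nz: "fst (snd s) mod (int p * int p) \<noteq> 0" "snd (snd s) mod (int p * int p) \<noteq> 0" "N mod int p \<noteq> 0"
    using cert unfolding trivial_zeros_cert_def s_def by (auto simp: Let_def)
  have per: "tripell_period b X p (nat N)" by (rule tripell_period_cert[OF p N(1) s_def s])
  interpret P: tripell_period b X p "nat N" by fact
  have NN: "int (nat N) = N" using N by simp
  have pp: "int p ^ 2 = int p * int p" by (simp add: power2_eq_square)
  have r1: "residues_at (int p) 1 (0, 0, 1)" by (simp add: residues_at_def X0 X1 X_neg)
  have "[X (N - 1) = fst (snd s)] (mod (int p * int p))" "[X N = snd (snd s)] (mod (int p * int p))"
    using residues_at_pow[OF N(1), of "int p * int p"] unfolding s_def[symmetric] by (auto simp: residues_at_def)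
  from this[THEN cong_dvd_iff] have 2: "\<not> int p ^ 2 dvd X (N - 1)" "\<not> int p ^ 2 dvd X N"
    using nz unfolding pp by (simp_all add: dvd_eq_mod_eq_0)
  show ?thesis
  proof unfold_locales
    show "\<not> int p dvd X i" if "0 < i" "i < int (nat N) - 1" for i
      using nonzero_run[OF run r1, of i] that N by simp
    show "\<not> p dvd nat N"
      using nz(3) NN by (metis dvd_imp_mod_0 int_dvd_int_iff)
  qed (use 2 NN in simp_all)
qed

section \<open>Integrality, the primes up to 250 and the final assembly\<close>

lemma rat_recurrence_integral:
  fixes x :: "int \<Rightarrow> rat" and b :: int
  assumes x: "\<And>n. x n = 2 * x (n - 1) + of_int b * x (n - 2) + x (n - 3)" "x 0 = 0" "x 1 = 1" "x 2 = 2"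
  obtains X where "tripell_seq b X" "x = (\<lambda>n. of_int (X n))"
proof -
  have r: "recurs b x" unfolding recurs_def
  proof
    fix n
    show "x (n + 3) = 2 * x (n + 2) + of_int b * x (n + 1) + x n" using x(1)[of "n + 3"] by (simp add: add.commute)
  qed
  have "x n \<in> \<int> \<and> x (n + 1) \<in> \<int> \<and> x (n + 2) \<in> \<int>" for n
  proof (induction n rule: int_induct[where k = 0])
    case base
    then show ?case using x(2-4) by simp
  next
    case (step1 n)
    moreover have "n + 1 + 1 = n + 2" "n + 1 + 2 = n + 3" by simp_all
    moreover have "x (n + 3) \<in> \<int>"
      unfolding recursD[OF r, of n] using step1 by (intro Ints_add Ints_mult) auto
    ultimately show ?case by (simp only:)
  next
    case (step2 n)
    have e: "n - 1 + 3 = n + 2" "n - 1 + 2 = n + 1" "n - 1 + 1 = n" by simp_all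
    \<comment> \<open>The trailing coefficient of the recurrence is 1, so integrality also
      propagates backwards.\<close>
    have "x (n - 1) = x (n + 2) - 2 * x (n + 1) - of_int b * x n"
      using recursD[OF r, of "n - 1"] unfolding e by simp
    moreover have "x (n + 2) - 2 * x (n + 1) - of_int b * x n \<in> \<int>"
      using step2 by (intro Ints_diff Ints_mult) auto
    moreover have "n - 1 + 2 = n + 1" by simp
    ultimately show ?case using step2 unfolding e by (simp only:)
  qed
  then have "x n \<in> \<int>" for n by blast
  then have X: "of_int \<lfloor>x n\<rfloor> = x n" for n by simp
  have "tripell_seq b (\<lambda>n. \<lfloor>x n\<rfloor>)"
  proof
    have "of_int \<lfloor>x (n + 3)\<rfloor> = (of_int (2 * \<lfloor>x (n + 2)\<rfloor> + b * \<lfloor>x (n + 1)\<rfloor> + \<lfloor>x n\<rfloor>) :: rat)" for n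
      unfolding of_int_add of_int_mult of_int_numeral X by (rule recursD[OF r])
    then show "recurs b (\<lambda>n. \<lfloor>x n\<rfloor>)" unfolding recurs_def of_int_eq_iff by simp
  qed (simp_all add: x(2-4))
  moreover have "x = (\<lambda>n. of_int \<lfloor>x n\<rfloor>)" by (simp add: X)
  ultimately show ?thesis using that by blast
qed

text \<open>Trial division by the primes up to 13 suffices, since 17^2 = 289 exceeds 250.\<close>

lemma primes_between_5_and_250:
  assumes "prime p" "p \<in> {5..250::nat}"
  shows "p \<in> {5, 7, 11, 13, 17, 19, 23, 29, 31, 37, 41, 43, 47, 53, 59, 61, 67, 71, 73, 79, 83, 89, 97, 101, 103, 107, 109, 113, 127, 131, 137, 139, 149, 151, 157, 163, 167, 173, 179, 181, 191, 193, 197, 199, 211, 223, 227, 229, 233, 239, 241}"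
proof -
  have d: "p mod d \<noteq> 0 \<or> p = d" if "d \<noteq> 1" for d
    using assms(1) that by (metis mod_eq_0_iff_dvd prime_nat_iff)
  have "p mod 2 \<noteq> 0" "p mod 3 \<noteq> 0" "p mod 5 \<noteq> 0 \<or> p = 5" "p mod 7 \<noteq> 0 \<or> p = 7"
    "p mod 11 \<noteq> 0 \<or> p = 11" "p mod 13 \<noteq> 0 \<or> p = 13"
    using assms(2) d[of 2] d[of 3] d[of 5] d[of 7] d[of 11] d[of 13] by simp_all
  moreover have "list_all (\<lambda>q. q mod 2 \<noteq> 0 \<longrightarrow> q mod 3 \<noteq> 0 \<longrightarrow> q mod 5 \<noteq> 0 \<or> q = 5 \<longrightarrow>
      q mod 7 \<noteq> 0 \<or> q = 7 \<longrightarrow> q mod 11 \<noteq> 0 \<or> q = 11 \<longrightarrow> q mod 13 \<noteq> 0 \<or> q = 13 \<longrightarrow>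
      q \<in> {5, 7, 11, 13, 17, 19, 23, 29, 31, 37, 41, 43, 47, 53, 59, 61, 67, 71, 73, 79, 83, 89, 97, 101, 103, 107, 109, 113, 127, 131, 137, 139, 149, 151, 157, 163, 167, 173, 179, 181, 191, 193, 197, 199, 211, 223, 227, 229, 233, 239, 241}) [5..<251]"
    by simp
  moreover have "p \<in> set [5..<251]"
    using assms(2) unfolding set_upt atLeastLessThan_iff atLeastAtMost_iff by linarith
  ultimately show ?thesis unfolding list_all_iff by blast
qed

text \<open>In the tuples \<open>(p, N, r, l)\<close>, \<open>N\<close> is the period modulo \<open>p\<close>, \<open>r\<close> is a zero modulo \<open>p\<close>
  and \<open>r + N * l\<close> is a zero modulo \<open>p\<^sup>2\<close>.\<close>

definition tripell_certs :: "(int \<times> int \<times> int \<times> int) list" where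
  "tripell_certs = [(7, 57, 6, 2), (11, 19, 5, 6), (13, 61, 4, 10), (17, 307, 63, 2), (23, 528, 16, 3),
    (31, 320, 26, 23), (37, 1368, 41, 32), (43, 231, 34, 13), (47, 2257, 15, 36),
    (53, 2808, 38, 41), (59, 435, 73, 39), (61, 744, 60, 14), (67, 4557, 16, 7),
    (71, 5040, 20, 14), (73, 1776, 145, 11), (79, 6240, 76, 17), (83, 3444, 100, 2),
    (89, 8011, 27, 11), (97, 3136, 21, 90), (101, 10303, 10, 29), (107, 11448, 7, 87),
    (109, 11991, 8, 6), (113, 12883, 35, 1), (127, 1008, 260, 29), (131, 17293, 239, 25),
    (139, 19461, 23, 24), (149, 11100, 178, 32), (157, 6162, 38, 91), (163, 1476, 123, 110),
    (167, 4648, 134, 94), (173, 1247, 139, 136), (179, 32040, 136, 77), (181, 32943, 511, 152),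
    (193, 18624, 621, 145), (197, 38808, 66, 158), (199, 39801, 205, 116), (211, 7420, 54, 46),
    (223, 49953, 549, 168), (227, 25764, 64, 91), (229, 52440, 136, 108), (233, 9048, 98, 221),
    (239, 57120, 32, 13), (241, 58323, 256, 108)]"

definition modified_tripell_certs :: "(int \<times> int \<times> int \<times> int) list" where
  "modified_tripell_certs = [(11, 133, 7, 6), (13, 168, 23, 7), (17, 307, 4, 9), (19, 360, 35, 1), (29, 67, 13, 24),
    (31, 993, 37, 22), (37, 1407, 55, 16), (43, 924, 13, 8), (47, 2208, 204, 38),
    (53, 702, 13, 26), (59, 3541, 51, 23), (61, 1261, 23, 1), (67, 2244, 120, 7),
    (71, 2520, 174, 38), (73, 5328, 27, 62), (79, 2080, 49, 44), (89, 660, 56, 23),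
    (97, 4704, 34, 77), (101, 1020, 35, 44), (103, 1326, 23, 69), (107, 2862, 60, 22),
    (109, 11991, 8, 104), (113, 12883, 84, 43), (127, 16257, 28, 112), (137, 9384, 18, 16),
    (139, 19320, 457, 133), (149, 5550, 33, 120), (151, 22953, 171, 35), (157, 24648, 714, 79),
    (163, 8856, 46, 17), (167, 28057, 156, 34), (173, 30103, 31, 152), (179, 10680, 490, 173),
    (181, 32760, 107, 25), (191, 36673, 362, 28), (197, 39007, 84, 110), (199, 198, 120, 33),
    (211, 14840, 19, 171), (223, 7104, 38, 77), (229, 228, 203, 17), (233, 54288, 85, 19),
    (239, 14280, 618, 147), (241, 58323, 120, 209)]"

lemma tripell_certs_valid: "list_all (nontrivial_zero_cert 1) tripell_certs"
  unfolding tripell_certs_def list.pred_inject nontrivial_zero_cert_def prod.case tripell_pow_numeral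
  by code_simp

lemma modified_tripell_certs_valid: "list_all (nontrivial_zero_cert 2) modified_tripell_certs"
  unfolding modified_tripell_certs_def list.pred_inject nontrivial_zero_cert_def prod.case tripell_pow_numeral
  by code_simp

text \<open>The extra numeral rules bring the run length into successor form, on which
  \<open>tripell_nonzero_run\<close> recurses.\<close>

lemma tripell_trivial_zeros_certs: "list_all (trivial_zeros_cert 1) [(103, 102, 100), (137, 136, 134), (191, 95, 93)]"
  unfolding list.pred_inject trivial_zeros_cert_def prod.case tripell_pow_numeral
    numeral_eq_Suc pred_numeral_simps BitM.simps
  by code_simp

lemma modified_tripell_trivial_zeros_certs: "list_all (trivial_zeros_cert 2) [(5, 8, 6), (23, 22, 20), (41, 40, 38), (131, 130, 128), (193, 192, 190), (227, 113, 111)]"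
  unfolding list.pred_inject trivial_zeros_cert_def prod.case tripell_pow_numeral
    numeral_eq_Suc pred_numeral_simps BitM.simps
  by code_simp

text \<open>The single prime \<open>q\<close> shows that 0 and -1 are the only integer zeros of
  \<open>X\<close>, which is the input for failure at every prime in \<open>fs\<close>.\<close>

lemma (in tripell_seq) marques_lengyel_by_certs:
  assumes b: "b = 1 \<or> b = 2"
    and fails: "list_all (nontrivial_zero_cert b) fs" and holds: "list_all (trivial_zeros_cert b) hs"
    and q: "(int q, M, k) \<in> set hs" "prime q" "q \<ge> 3"
  shows "prime p \<Longrightarrow> p \<ge> 3 \<Longrightarrow> int p \<in> fst ` set fs \<Longrightarrow> \<not> marques_lengyel (\<lambda>n. of_int (X n)) p"
    and "prime p \<Longrightarrow> p \<ge> 3 \<Longrightarrow> int p \<in> fst ` set hs \<Longrightarrow> marques_lengyel (\<lambda>n. of_int (X n)) p"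
proof -
  have "trivial_zeros_cert b (int q, M, k)" using holds q(1) by (auto simp: list_all_iff)
  then interpret Q: tripell_trivial_zeros b X q "nat M"
    by (rule trivial_zeros_cert_sound[OF q(2,3)])
  show "\<not> marques_lengyel (\<lambda>n. of_int (X n)) p" if p: "prime p" "p \<ge> 3" "int p \<in> fst ` set fs"
  proof -
    from p(3) obtain N r l where "(int p, N, r, l) \<in> set fs" by force
    then have "nontrivial_zero_cert b (int p, N, r, l)" using fails by (auto simp: list_all_iff)
    then show ?thesis using nontrivial_zero_cert_sound[OF b _ p(1,2)] Q.zeros by blast
  qed
  show "marques_lengyel (\<lambda>n. of_int (X n)) p" if p: "prime p" "p \<ge> 3" "int p \<in> fst ` set hs"
  proof -
    from p(3) obtain N k where "(int p, N, k) \<in> set hs" by force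
    then have "trivial_zeros_cert b (int p, N, k)" using holds by (auto simp: list_all_iff)
    from trivial_zeros_cert_sound[OF p(1,2) this] show ?thesis by (rule tripell_trivial_zeros.holds)
  qed
qed

theorem theorem1p9:
  shows
    "(\<forall>x. is_tripell x \<longrightarrow>
        (\<forall>p::nat. prime p \<and> p \<in> {5..250} - {5, 19, 29, 41, 103, 137, 151, 191}
            \<longrightarrow> \<not> marques_lengyel x p) \<and>
        (\<forall>p\<in>{103, 137, 191}. marques_lengyel x p))
     \<and>
     (\<forall>x. is_modified_tripell x \<longrightarrow>
        (\<forall>p::nat. prime p \<and> p \<in> {5..250} - {5, 7, 23, 41, 83, 131, 193, 227}
            \<longrightarrow> \<not> marques_lengyel x p) \<and>
        (\<forall>p\<in>{5, 23, 41, 131, 193, 227}. marques_lengyel x p))"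
proof (intro conjI allI impI ballI)
  fix x :: "int \<Rightarrow> rat"
  assume x: "is_tripell x"
  obtain X where X: "tripell_seq 1 X" "x = (\<lambda>n. of_int (X n))"
  proof (rule rat_recurrence_integral[of x 1])
    show "x n = 2 * x (n - 1) + of_int 1 * x (n - 2) + x (n - 3)" for n
      using x[unfolded is_tripell_def, THEN conjunct1, rule_format, of n] by simp
  qed (use x[unfolded is_tripell_def, THEN conjunct2] in simp_all)
  interpret tripell_seq 1 X by fact
  \<comment> \<open>The integer zeros are determined at the prime 103, with period 102.\<close>
  note certs = marques_lengyel_by_certs[OF _ tripell_certs_valid tripell_trivial_zeros_certs, of 103 102 100]
  show "\<not> marques_lengyel x p"
    if "prime p \<and> p \<in> {5..250} - {5, 19, 29, 41, 103, 137, 151, 191}" for p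
    unfolding X(2)
    by (rule certs(1)) (use that primes_between_5_and_250[of p] in \<open>auto simp: tripell_certs_def\<close>)
  show "marques_lengyel x p" if "p \<in> {103, 137, 191}" for p
    unfolding X(2) by (rule certs(2)) (use that in auto)
next
  fix x :: "int \<Rightarrow> rat"
  assume x: "is_modified_tripell x"
  obtain X where X: "tripell_seq 2 X" "x = (\<lambda>n. of_int (X n))"
  proof (rule rat_recurrence_integral[of x 2])
    show "x n = 2 * x (n - 1) + of_int 2 * x (n - 2) + x (n - 3)" for n
      using x[unfolded is_modified_tripell_def, THEN conjunct1, rule_format, of n] by simp
  qed (use x[unfolded is_modified_tripell_def, THEN conjunct2] in simp_all)
  interpret tripell_seq 2 X by fact
  \<comment> \<open>The integer zeros are determined at the prime 5, with period 8.\<close>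
  note certs = marques_lengyel_by_certs[OF _ modified_tripell_certs_valid modified_tripell_trivial_zeros_certs, of 5 8 6]
  show "\<not> marques_lengyel x p"
    if "prime p \<and> p \<in> {5..250} - {5, 7, 23, 41, 83, 131, 193, 227}" for p
    unfolding X(2)
    by (rule certs(1)) (use that primes_between_5_and_250[of p] in \<open>auto simp: modified_tripell_certs_def\<close>)
  show "marques_lengyel x p" if "p \<in> {5, 23, 41, 131, 193, 227}" for p
    unfolding X(2) by (rule certs(2)) (use that in auto)
qed

end
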